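(* Let $E\subseteq\mathbb{C}$ be a finite Galois extension of $\mathbb{Q}$, let $\mathfrak{n}^{\mathbb{Q}}$ be a finite-dimensional rational Lie algebra and $\rho:\mathrm{Gal}(E,\mathbb{Q})\to\mathrm{Aut}(\mathfrak{n}^{\mathbb{Q}})$ a representation. Suppose $f:\mathfrak{n}^E\to\mathfrak{n}^E$ is a Lie algebra automorphism with $\rho_\sigma f\rho_{\sigma^{-1}}=f^\sigma$ for all $\sigma\in\mathrm{Gal}(E,\mathbb{Q})$. Then there exists a rational form $\mathfrak{m}^{\mathbb{Q}}\subseteq\mathfrak{n}^E$ such that $f(\mathfrak{m}^{\mathbb{Q}})=\mathfrak{m}^{\mathbb{Q}}$. If moreover all eigenvalues of $f$ are algebraic units of absolute value different from $1$, then $\mathfrak{m}^{\mathbb{Q}}$ is Anosov (the restriction of $f$ being an Anosov automorphism of it).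
   Context: $\mathfrak{n}^E=E\otimes_{\mathbb{Q}}\mathfrak{n}^{\mathbb{Q}}$; $\mathrm{Gal}(E,\mathbb{Q})$ acts on the right on $\mathfrak{n}^E$ by $(x\otimes X)^\sigma=\sigma^{-1}(x)\otimes X$, and on $\mathrm{Aut}(\mathfrak{n}^E)$ by $f^\sigma(v)=\big(f(v^{\sigma^{-1}})\big)^\sigma$ (matrix of $f^\sigma$ w.r.t. a $\mathbb{Q}$-basis of $\mathfrak{n}^{\mathbb{Q}}$ = entrywise $\sigma^{-1}$ applied to the matrix of $f$). Each $\rho_\sigma$ is extended $E$-linearly to $\mathfrak{n}^E$. A rational form of $\mathfrak{n}^E$ is a rational Lie subalgebra $\mathfrak{m}^{\mathbb{Q}}\subseteq\mathfrak{n}^E$ such that a $\mathbb{Q}$-basis of $\mathfrak{m}^{\mathbb{Q}}$ is an $E$-basis of $\mathfrak{n}^E$. An automorphism of a Lie algebra over a field $F\subseteq\mathbb{C}$ is Anosov if it is hyperbolic (no eigenvalue of absolute value $1$) and integer-like (its characteristic polynomial has integer coefficients and its determinant has absolute value $1$). A rational Lie algebra is Anosov if it admits an Anosov automorphism. *)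

theory Defs
  imports "HOL-Analysis.Analysis" "HOL-Computational_Algebra.Polynomial"
begin

definition subfield_C :: "complex set \<Rightarrow> bool" where
  "subfield_C E \<longleftrightarrow> 0 \<in> E \<and> 1 \<in> E \<and>
     (\<forall>x\<in>E. \<forall>y\<in>E. x + y \<in> E \<and> x - y \<in> E \<and> x * y \<in> E) \<and>
     (\<forall>x\<in>E. x \<noteq> 0 \<longrightarrow> inverse x \<in> E)"

definition finite_over_Q :: "complex set \<Rightarrow> bool" where
  "finite_over_Q E \<longleftrightarrow> (\<exists>B. finite B \<and> B \<subseteq> E \<and>
     (\<forall>x\<in>E. \<exists>q :: complex \<Rightarrow> rat. x = (\<Sum>b\<in>B. of_rat (q b) * b)))"

text \<open>Normality: every complex conjugate of an element of E (i.e. every common root of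
  all rational polynomials vanishing at it, i.e. every root of its minimal polynomial) lies in E.
  In characteristic 0 normal = Galois.\<close>
definition normal_over_Q :: "complex set \<Rightarrow> bool" where
  "normal_over_Q E \<longleftrightarrow> (\<forall>x\<in>E. \<forall>z :: complex.
     (\<forall>p :: rat poly. p \<noteq> 0 \<longrightarrow> poly (map_poly of_rat p) x = 0 \<longrightarrow> poly (map_poly of_rat p) z = 0)
       \<longrightarrow> z \<in> E)"

definition finite_galois_ext_Q :: "complex set \<Rightarrow> bool" where
  "finite_galois_ext_Q E \<longleftrightarrow> subfield_C E \<and> finite_over_Q E \<and> normal_over_Q E"

text \<open>Gal(E,Q): field automorphisms of E; normalised to be the identity outside E
  so that each automorphism has a unique representative.\<close>
definition Gal :: "complex set \<Rightarrow> (complex \<Rightarrow> complex) set" where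
  "Gal E = {\<sigma>. bij_betw \<sigma> E E \<and> \<sigma> 1 = 1 \<and>
     (\<forall>x\<in>E. \<forall>y\<in>E. \<sigma> (x + y) = \<sigma> x + \<sigma> y \<and> \<sigma> (x * y) = \<sigma> x * \<sigma> y) \<and>
     (\<forall>z. z \<notin> E \<longrightarrow> \<sigma> z = z)}"

section \<open>Lie algebras given by rational structure constants w.r.t. a basis indexed by 'n\<close>

definition brk :: "('n::finite \<Rightarrow> 'n \<Rightarrow> 'n \<Rightarrow> rat) \<Rightarrow> 'a::field_char_0 ^ 'n \<Rightarrow> 'a ^ 'n \<Rightarrow> 'a ^ 'n" where
  "brk c v w = (\<chi> k. \<Sum>i\<in>UNIV. \<Sum>j\<in>UNIV. v $ i * w $ j * of_rat (c i j k))"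

definition lie_algebra_Q :: "('n::finite \<Rightarrow> 'n \<Rightarrow> 'n \<Rightarrow> rat) \<Rightarrow> bool" where
  "lie_algebra_Q c \<longleftrightarrow> (\<forall>v :: rat ^ 'n. brk c v v = 0) \<and>
     (\<forall>u v w :: rat ^ 'n. brk c u (brk c v w) + brk c v (brk c w u) + brk c w (brk c u v) = 0)"

definition lie_aut_Q :: "('n::finite \<Rightarrow> 'n \<Rightarrow> 'n \<Rightarrow> rat) \<Rightarrow> rat ^ 'n ^ 'n \<Rightarrow> bool" where
  "lie_aut_Q c A \<longleftrightarrow> invertible A \<and> (\<forall>v w. A *v brk c v w = brk c (A *v v) (A *v w))"

text \<open>n^E = E \<otimes> n^Q, realised as the vectors with coordinates in E.\<close>
definition nE :: "complex set \<Rightarrow> (complex ^ 'n::finite) set" where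
  "nE E = {v. \<forall>i. v $ i \<in> E}"

definition mat_in :: "complex set \<Rightarrow> complex ^ 'n ^ 'm \<Rightarrow> bool" where
  "mat_in E f \<longleftrightarrow> (\<forall>i j. f $ i $ j \<in> E)"

definition ratmat :: "rat ^ 'n ^ 'm \<Rightarrow> complex ^ 'n ^ 'm" where
  "ratmat A = (\<chi> i j. of_rat (A $ i $ j))"

definition lie_aut_E :: "complex set \<Rightarrow> ('n::finite \<Rightarrow> 'n \<Rightarrow> 'n \<Rightarrow> rat) \<Rightarrow> complex ^ 'n ^ 'n \<Rightarrow> bool" where
  "lie_aut_E E c f \<longleftrightarrow> mat_in E f \<and> bij_betw (\<lambda>v. f *v v) (nE E) (nE E) \<and>
     (\<forall>v\<in>nE E. \<forall>w\<in>nE E. f *v brk c v w = brk c (f *v v) (f *v w))"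

definition gal_twist :: "(complex \<Rightarrow> complex) \<Rightarrow> complex ^ 'n ^ 'm \<Rightarrow> complex ^ 'n ^ 'm" where
  "gal_twist \<sigma> f = (\<chi> i j. inv \<sigma> (f $ i $ j))"

definition gal_rep :: "complex set \<Rightarrow> ('n::finite \<Rightarrow> 'n \<Rightarrow> 'n \<Rightarrow> rat) \<Rightarrow> ((complex \<Rightarrow> complex) \<Rightarrow> rat ^ 'n ^ 'n) \<Rightarrow> bool" where
  "gal_rep E c \<rho> \<longleftrightarrow> (\<forall>\<sigma>\<in>Gal E. lie_aut_Q c (\<rho> \<sigma>)) \<and>
     (\<forall>\<sigma>\<in>Gal E. \<forall>\<tau>\<in>Gal E. \<rho> (\<sigma> \<circ> \<tau>) = \<rho> \<sigma> ** \<rho> \<tau>)"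

definition Q_basis :: "(complex ^ 'n::finite) set \<Rightarrow> ('i::finite \<Rightarrow> complex ^ 'n) \<Rightarrow> bool" where
  "Q_basis m b \<longleftrightarrow> (\<forall>i. b i \<in> m) \<and>
     (\<forall>v\<in>m. \<exists>!q :: 'i \<Rightarrow> rat. v = (\<Sum>i\<in>UNIV. of_rat (q i) *s b i))"

definition E_basis :: "complex set \<Rightarrow> ('i::finite \<Rightarrow> complex ^ 'n::finite) \<Rightarrow> bool" where
  "E_basis E b \<longleftrightarrow> (\<forall>i. b i \<in> nE E) \<and>
     (\<forall>v\<in>nE E. \<exists>!a :: 'i \<Rightarrow> complex. (\<forall>i. a i \<in> E) \<and> v = (\<Sum>i\<in>UNIV. a i *s b i))"

definition rational_subalgebra :: "('n::finite \<Rightarrow> 'n \<Rightarrow> 'n \<Rightarrow> rat) \<Rightarrow> (complex ^ 'n) set \<Rightarrow> bool" where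
  "rational_subalgebra c m \<longleftrightarrow> 0 \<in> m \<and> (\<forall>v\<in>m. \<forall>w\<in>m. v + w \<in> m \<and> brk c v w \<in> m) \<and>
     (\<forall>q :: rat. \<forall>v\<in>m. of_rat q *s v \<in> m)"

text \<open>A rational form of n^E: a rational Lie subalgebra of n^E such that a Q-basis of it
  is an E-basis of n^E (any Q-basis has CARD('n) elements then, so we index it by 'n).\<close>
definition rational_form :: "complex set \<Rightarrow> ('n::finite \<Rightarrow> 'n \<Rightarrow> 'n \<Rightarrow> rat) \<Rightarrow> (complex ^ 'n) set \<Rightarrow> bool" where
  "rational_form E c m \<longleftrightarrow> m \<subseteq> nE E \<and> rational_subalgebra c m \<and>
     (\<exists>b :: 'n \<Rightarrow> complex ^ 'n. Q_basis m b \<and> E_basis E b)"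

definition charpoly :: "'a::comm_ring_1 ^ 'n::finite ^ 'n \<Rightarrow> 'a poly" where
  "charpoly A = det (\<chi> i j. (if i = j then [:0, 1:] else 0) - [:A $ i $ j:])"

definition eigenvalue :: "complex ^ 'n::finite ^ 'n \<Rightarrow> complex \<Rightarrow> bool" where
  "eigenvalue f z \<longleftrightarrow> (\<exists>v. v \<noteq> 0 \<and> f *v v = z *s v)"

definition hyperbolic_Q :: "rat ^ 'n::finite ^ 'n \<Rightarrow> bool" where
  "hyperbolic_Q A \<longleftrightarrow> (\<forall>z. eigenvalue (ratmat A) z \<longrightarrow> cmod z \<noteq> 1)"

definition integer_like_Q :: "rat ^ 'n::finite ^ 'n \<Rightarrow> bool" where
  "integer_like_Q A \<longleftrightarrow> (\<forall>k. coeff (charpoly A) k \<in> \<int>) \<and> \<bar>det A\<bar> = 1"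

definition anosov_Q :: "('n::finite \<Rightarrow> 'n \<Rightarrow> 'n \<Rightarrow> rat) \<Rightarrow> rat ^ 'n ^ 'n \<Rightarrow> bool" where
  "anosov_Q c A \<longleftrightarrow> lie_aut_Q c A \<and> hyperbolic_Q A \<and> integer_like_Q A"

definition algebraic_int :: "complex \<Rightarrow> bool" where
  "algebraic_int x \<longleftrightarrow> (\<exists>p :: int poly. lead_coeff p = 1 \<and> poly (map_poly of_int p) x = 0)"

definition algebraic_unit :: "complex \<Rightarrow> bool" where
  "algebraic_unit x \<longleftrightarrow> x \<noteq> 0 \<and> algebraic_int x \<and> algebraic_int (inverse x)"

end

theory Submission
  imports Defs
    "HOL-Computational_Algebra.Polynomial_Factorial"
    "HOL-Computational_Algebra.Field_as_Ring"
    "HOL-Computational_Algebra.Fundamental_Theorem_Algebra"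
begin

text \<open>The rational form is the fixed space of the twisted semilinear action
  \<open>\<sigma> \<cdot> v = \<rho>\<^sub>\<sigma> (\<sigma>(v))\<close> of the Galois group on \<open>\<nn>\<^sup>E\<close>. The hypothesis on \<open>f\<close> says
  precisely that \<open>f\<close> commutes with this action, so \<open>f\<close> preserves the fixed space. Traces
  \<open>\<Sum>\<sigma>. \<sigma> \<cdot> (x v)\<close> lie in the fixed space and span, and a basis of fixed vectors expresses
  every fixed vector with Galois invariant, hence rational, coordinates. The characteristic
  polynomials of the rational matrix of \<open>f\<close> and of its inverse are monic with algebraic integer
  roots, so by Gauss's lemma they are integral, which gives determinant \<open>\<plusminus>1\<close>.\<close>

section \<open>Finite extensions of the rationals\<close>

text \<open>The field enters as a mere set of complex numbers, and its Galois theory is channelled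
  through one element: with E = Q[\<theta>], an automorphism amounts to a choice of a conjugate of
  \<theta>. This makes the group finite, identifies its fixed field with Q, and separates the
  automorphisms when the traces are shown to span. Spanning is first proved over the complex
  numbers, where a basis matrix with nonzero determinant is selected inside the fixed space.
  Cramer's rule then brings coordinates back into E, and Galois invariance brings them from E to Q.
  The action applies \<sigma> to the entries, whereas \<open>gal_twist \<sigma>\<close> applies its
  inverse; commuting with the action of \<sigma> is therefore the hypothesis taken at
  \<open>inv \<sigma>\<close>. The fixed space is closed under the bracket because the structure
  constants are rational, hence fixed by \<sigma>, and \<open>\<rho> \<sigma>\<close> is an
  automorphism.\<close>

abbreviation cpoly :: "rat poly \<Rightarrow> complex poly" where
  "cpoly \<equiv> map_poly of_rat"

lemma cpoly_coeff [simp]: "coeff (cpoly p) i = of_rat (coeff p i)"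
  by (simp add: coeff_map_poly)

lemma cpoly_add [simp]: "cpoly (p + q) = cpoly p + cpoly q"
  by (rule poly_eqI) (simp add: of_rat_add)

lemma cpoly_diff [simp]: "cpoly (p - q) = cpoly p - cpoly q"
  by (rule poly_eqI) (simp add: of_rat_diff)

lemma cpoly_mult [simp]: "cpoly (p * q) = cpoly p * cpoly q"
  by (rule poly_eqI) (simp add: coeff_mult of_rat_sum of_rat_mult)

lemma cpoly_pCons [simp]: "cpoly (pCons a p) = pCons (of_rat a) (cpoly p)"
  by (simp add: map_poly_pCons)

lemma cpoly_pderiv: "cpoly (pderiv p) = pderiv (cpoly p)"
  by (rule poly_eqI) (simp add: coeff_pderiv of_rat_mult of_rat_add)

lemma cpoly_pcompose: "cpoly (pcompose p q) = pcompose (cpoly p) (cpoly q)"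
  by (induction p) (simp_all add: pcompose_pCons)

lemma degree_cpoly [simp]: "degree (cpoly p) = degree p"
  by (rule degree_map_poly) simp

lemma cpoly_eq_0_iff [simp]: "cpoly p = 0 \<longleftrightarrow> p = 0"
  by (auto simp: poly_eq_iff)

section \<open>Irreducible rational polynomials as minimal polynomials\<close>

lemma irreducible_bezout:
  fixes p g :: "rat poly"
  assumes "irreducible p" "\<not> p dvd g"
  obtains u v where "u * p + v * g = 1"
proof -
  have "coprime p g"
    by (rule prime_elem_imp_coprime[OF field_poly_irreducible_imp_prime[OF assms(1)] assms(2)])
  then show ?thesis
    by (metis bezout_coefficients_fst_snd coprime_imp_gcd_eq_1 that)
qed

text \<open>Otherwise a Bezout identity evaluated at z would read 0 = 1. Thus any irreducible
  rational polynomial vanishing at z does the work of the minimal polynomial of z, without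
  normalisation.\<close>

lemma irreducible_dvd_of_common_root:
  fixes p g :: "rat poly"
  assumes "irreducible p" "poly (cpoly p) z = 0" "poly (cpoly g) z = 0"
  shows "p dvd g"
proof (rule ccontr)
  assume "\<not> p dvd g"
  then obtain u v where "u * p + v * g = 1"
    using irreducible_bezout[OF assms(1)] by blast
  then have "poly (cpoly (u * p + v * g)) z = 1"
    by simp
  then show False
    using assms by simp
qed

text \<open>This is the conjugacy relation from which automorphisms are built: used in both
  directions it makes the substitution of z for y in polynomial values well defined and
  injective.\<close>

lemma irreducible_conjugate_roots:
  fixes p g :: "rat poly"
  assumes "irreducible p" "poly (cpoly p) y = 0" "poly (cpoly p) z = 0" "poly (cpoly g) y = 0"
  shows "poly (cpoly g) z = 0"
proof -
  obtain k where "g = p * k"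
    using irreducible_dvd_of_common_root[OF assms(1,2,4)] by (auto elim: dvdE)
  then show ?thesis
    using assms(3) by simp
qed

text \<open>A double root would be shared with the derivative, so p would divide its own derivative;
  in characteristic zero that is a nonzero polynomial of smaller degree.\<close>

lemma irreducible_rsquarefree:
  fixes p :: "rat poly"
  assumes "irreducible p"
  shows "rsquarefree (cpoly p)"
  unfolding rsquarefree_roots
proof (intro allI notI, elim conjE)
  fix z assume z: "poly (cpoly p) z = 0" "poly (pderiv (cpoly p)) z = 0"
  have "p dvd pderiv p"
    by (rule irreducible_dvd_of_common_root[OF assms z(1)]) (use z(2) in \<open>simp only: cpoly_pderiv\<close>)
  moreover have "degree p \<noteq> 0"
    using assms is_unit_iff_degree[of p] by (auto simp: irreducible_def)
  ultimately show False
    using not_dvd_pderiv by blast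
qed

lemma card_roots_rsquarefree:
  fixes p :: "complex poly"
  assumes "rsquarefree p"
  shows "card {z. poly p z = 0} = degree p"
proof -
  have p0: "p \<noteq> 0"
    using assms by (auto simp: rsquarefree_def)
  have "degree p = degree (smult (lead_coeff p) (\<Prod>z|poly p z = 0. [:-z, 1:]))"
    using complex_poly_decompose_rsquarefree[OF assms] by simp
  also have "\<dots> = degree (\<Prod>z|poly p z = 0. [:-z, 1:])"
    using p0 by simp
  also have "\<dots> = (\<Sum>z|poly p z = 0. degree [:-z, 1:])"
    by (rule degree_prod_eq_sum_degree) auto
  finally show ?thesis by simp
qed

definition algebraic_Q :: "complex \<Rightarrow> bool" where
  "algebraic_Q x \<longleftrightarrow> (\<exists>p. p \<noteq> 0 \<and> poly (cpoly p) x = 0)"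

text \<open>Take a polynomial of least degree among those killing x. In any factorisation one factor
  again kills x, so it has full degree and the other is constant.\<close>

lemma algebraic_Q_irreducibleE:
  assumes "algebraic_Q x"
  obtains p where "irreducible p" "poly (cpoly p) x = 0"
proof -
  define P where "P p \<longleftrightarrow> p \<noteq> 0 \<and> poly (cpoly p) x = 0" for p
  obtain p0 where "P p0"
    using assms by (auto simp: algebraic_Q_def P_def)
  then obtain p where p: "P p" and min: "\<And>q. P q \<Longrightarrow> degree p \<le> degree q"
    using ex_has_least_nat[of P p0 degree] by blast
  have "irreducible p"
  proof (rule irreducibleI)
    show "p \<noteq> 0" using p by (simp add: P_def)
    show "\<not> is_unit p"
      using p by (auto simp: P_def is_unit_poly_iff)
    fix a b assume ab: "p = a * b"
    have nz: "a \<noteq> 0" "b \<noteq> 0" using ab p by (auto simp: P_def)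
    have deg: "degree p = degree a + degree b"
      using ab nz by (simp add: degree_mult_eq)
    have "P a \<or> P b"
      using p ab nz by (auto simp: P_def)
    then have "degree a = 0 \<or> degree b = 0"
      using min[of a] min[of b] deg by auto
    then show "is_unit a \<or> is_unit b"
      using nz by (auto simp: is_unit_iff_degree)
  qed
  then show ?thesis using p that by (auto simp: P_def)
qed

section \<open>Subfields of the complex numbers and polynomials over them\<close>

context
  fixes K :: "complex set"
  assumes K: "subfield_C K"
begin

lemma subfield_0: "0 \<in> K" and subfield_1: "1 \<in> K"
  and subfield_add: "x \<in> K \<Longrightarrow> y \<in> K \<Longrightarrow> x + y \<in> K"
  and subfield_diff: "x \<in> K \<Longrightarrow> y \<in> K \<Longrightarrow> x - y \<in> K"
  and subfield_mult: "x \<in> K \<Longrightarrow> y \<in> K \<Longrightarrow> x * y \<in> K"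
  using K by (auto simp: subfield_C_def)

lemma subfield_uminus: "x \<in> K \<Longrightarrow> - x \<in> K"
  using subfield_diff[OF subfield_0, of x] by simp

lemma subfield_inverse: "x \<in> K \<Longrightarrow> inverse x \<in> K"
  using K by (cases "x = 0") (auto simp: subfield_C_def)

lemma subfield_divide: "x \<in> K \<Longrightarrow> y \<in> K \<Longrightarrow> x / y \<in> K"
  by (simp add: divide_inverse subfield_mult subfield_inverse)

lemma subfield_sum: "(\<And>i. i \<in> I \<Longrightarrow> g i \<in> K) \<Longrightarrow> sum g I \<in> K"
  by (induction I rule: infinite_finite_induct) (auto simp: subfield_0 subfield_add)

lemma subfield_prod: "(\<And>i. i \<in> I \<Longrightarrow> g i \<in> K) \<Longrightarrow> prod g I \<in> K"
  by (induction I rule: infinite_finite_induct) (auto simp: subfield_1 subfield_mult)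

lemma subfield_power: "x \<in> K \<Longrightarrow> x ^ n \<in> K"
  by (induction n) (auto simp: subfield_1 subfield_mult)

lemma subfield_of_nat: "of_nat n \<in> K"
  by (induction n) (auto simp: subfield_0 subfield_1 subfield_add)

lemma subfield_of_int: "of_int k \<in> K"
  by (cases k rule: int_cases2) (auto simp: subfield_of_nat subfield_uminus)

lemma subfield_of_rat: "of_rat q \<in> K"
proof -
  obtain a b where "quotient_of q = (a, b)" by fastforce
  then have "q = of_int a / of_int b" by (rule quotient_of_div)
  then show ?thesis
    by (simp add: of_rat_divide subfield_divide subfield_of_int)
qed

lemma subfield_poly:
  assumes "\<And>i. coeff p i \<in> K" "x \<in> K"
  shows "poly p x \<in> K"
  unfolding poly_altdef by (intro subfield_sum subfield_mult subfield_power assms)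

lemma subfield_poly_cpoly: "x \<in> K \<Longrightarrow> poly (cpoly p) x \<in> K"
  by (intro subfield_poly) (auto simp: subfield_of_rat)

lemma subfield_coeff_mult:
  assumes "\<And>i. coeff p i \<in> K" "\<And>i. coeff q i \<in> K"
  shows "coeff (p * q) i \<in> K"
  unfolding coeff_mult by (intro subfield_sum subfield_mult assms)

lemma subfield_coeff_pcompose:
  assumes "\<And>i. coeff p i \<in> K" "\<And>i. coeff q i \<in> K"
  shows "coeff (pcompose p q) i \<in> K"
  using assms(1)
proof (induction p arbitrary: i)
  case (pCons a p)
  have "a \<in> K" "\<And>i. coeff p i \<in> K"
    using pCons.prems[of 0] pCons.prems[of "Suc i" for i] by auto
  then show ?case
    using pCons.IH assms(2)
    by (auto simp: pcompose_pCons coeff_pCons subfield_0 split: nat.split intro!: subfield_add subfield_coeff_mult)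
qed (simp add: subfield_0)

text \<open>Subtracting the multiple of h that cancels the leading term keeps the coefficients in K
  and the zero at x, and either lowers the degree or yields 0. As K is a set and not a type, this
  division is carried out by induction on the degree.\<close>

lemma minimal_degree_dvd:
  assumes h: "\<And>i. coeff h i \<in> K" "h \<noteq> 0" "poly h x = 0"
    and min: "\<And>g. (\<And>i. coeff g i \<in> K) \<Longrightarrow> g \<noteq> 0 \<Longrightarrow> poly g x = 0 \<Longrightarrow> degree h \<le> degree g"
    and f: "\<And>i. coeff f i \<in> K" "poly f x = 0"
  shows "h dvd f"
  using f
proof (induction "degree f" arbitrary: f rule: less_induct)
  case less
  show ?case
  proof (cases "f = 0")
    case False
    then have le: "degree h \<le> degree f"
      using min less.prems by blast
    define m where "m = monom (lead_coeff f / lead_coeff h) (degree f - degree h)"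
    have mK: "coeff m i \<in> K" for i
      using less.prems(1) h(1) by (simp add: m_def subfield_divide subfield_0)
    have gK: "coeff (f - m * h) i \<in> K" for i
      unfolding coeff_diff by (intro subfield_diff subfield_coeff_mult less.prems mK h(1))
    have gx: "poly (f - m * h) x = 0"
      using less.prems h by simp
    have deg_m: "degree m = degree f - degree h"
      unfolding m_def by (rule degree_monom_eq) (use False h(2) in auto)
    have m0: "m \<noteq> 0" using False h(2) by (simp add: m_def)
    have deg_mh: "degree (m * h) = degree f"
      using m0 h(2) le deg_m by (simp add: degree_mult_eq)
    have lc: "lead_coeff (m * h) = lead_coeff f"
      using h(2) unfolding lead_coeff_mult deg_m by (simp add: m_def)
    have "f - m * h = 0 \<or> degree (f - m * h) < degree f"
    proof (cases "degree f = 0")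
      case True
      then show ?thesis using lc deg_mh
        by (metis coeff_diff degree_diff_le eq_iff_diff_eq_0 le_zero_eq leading_coeff_0_iff order_refl)
    next
      case False
      then show ?thesis using lc deg_mh
        by (metis coeff_diff degree_diff_le eq_iff_diff_eq_0 leading_coeff_0_iff nat_less_le order_refl)
    qed
    then have "h dvd f - m * h"
      using less.hyps gK gx by auto
    then have "h dvd (f - m * h) + m * h"
      by (intro dvd_add) auto
    then show ?thesis by simp
  qed auto
qed

end

section \<open>Simple extensions and the primitive element theorem\<close>

definition Q_adjoin :: "complex \<Rightarrow> complex set" where
  "Q_adjoin x = range (\<lambda>g. poly (cpoly g) x)"

lemma Q_adjoinI: "y = poly (cpoly g) x \<Longrightarrow> y \<in> Q_adjoin x"
  by (auto simp: Q_adjoin_def)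

text \<open>Algebraicity is what provides inverses: a polynomial not divisible by an irreducible p
  vanishing at x has a Bezout inverse modulo p. Polynomial values therefore already form
  Q(x).\<close>

lemma subfield_Q_adjoin:
  assumes "algebraic_Q x"
  shows "subfield_C (Q_adjoin x)"
  unfolding subfield_C_def
proof (intro conjI ballI impI)
  show "0 \<in> Q_adjoin x" by (rule Q_adjoinI[of _ 0]) simp
  show "1 \<in> Q_adjoin x" by (rule Q_adjoinI[of _ 1]) simp
next
  fix y z assume "y \<in> Q_adjoin x" "z \<in> Q_adjoin x"
  then obtain g h where "y = poly (cpoly g) x" "z = poly (cpoly h) x"
    by (auto simp: Q_adjoin_def)
  then show "y + z \<in> Q_adjoin x" "y - z \<in> Q_adjoin x" "y * z \<in> Q_adjoin x"
    by (auto intro: Q_adjoinI[of _ "g + h"] Q_adjoinI[of _ "g - h"] Q_adjoinI[of _ "g * h"])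
next
  fix y assume y: "y \<in> Q_adjoin x" "y \<noteq> 0"
  then obtain g where g: "y = poly (cpoly g) x"
    by (auto simp: Q_adjoin_def)
  obtain p where p: "irreducible p" "poly (cpoly p) x = 0"
    using assms algebraic_Q_irreducibleE by blast
  have "\<not> p dvd g"
    using g y(2) p(2) by (auto elim!: dvdE)
  then obtain u v where uv: "u * p + v * g = 1"
    using irreducible_bezout[OF p(1)] by blast
  have "poly (cpoly (u * p + v * g)) x = 1"
    unfolding uv by simp
  then have "poly (cpoly v) x * y = 1"
    using p g by simp
  then have "inverse y = poly (cpoly v) x"
    by (metis inverse_unique mult.commute)
  then show "inverse y \<in> Q_adjoin x" by (rule Q_adjoinI)
qed

lemma Q_adjoin_self: "x \<in> Q_adjoin x"
  by (rule Q_adjoinI[of _ "[:0, 1:]"]) simp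

lemma Q_adjoin_subset: "y \<in> Q_adjoin x \<Longrightarrow> Q_adjoin y \<subseteq> Q_adjoin x"
  by (auto simp: Q_adjoin_def simp flip: poly_pcompose cpoly_pcompose)

text \<open>For all but finitely many c, the element \<gamma> = a + c b determines b: among the
  roots z of q, only z = b makes \<gamma> - c z a root of p. Hence the minimal polynomial of b over
  Q(\<gamma>) has b as its single root, which is simple, so it is linear and b lies in Q(\<gamma>).
  Algebraicity of the sums is a premise because in the application they lie in E.\<close>

lemma Q_adjoin_two:
  assumes a: "algebraic_Q a" and b: "algebraic_Q b"
    and alg: "\<And>c. algebraic_Q (a + of_rat c * b)"
  obtains c where "a \<in> Q_adjoin (a + of_rat c * b)" "b \<in> Q_adjoin (a + of_rat c * b)"
proof -
  obtain p where p: "irreducible p" "poly (cpoly p) a = 0"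
    using a algebraic_Q_irreducibleE by blast
  obtain q where q: "irreducible q" "poly (cpoly q) b = 0"
    using b algebraic_Q_irreducibleE by blast
  have p0: "p \<noteq> 0" "q \<noteq> 0" using p q by auto
  \<comment> \<open>Solutions c of a' + c b' = a + c b with a', b' roots of p, q. Pairs with b' = b
    yield the value 0 through division by zero, so they merely exclude c = 0.\<close>
  define bad where "bad = (\<lambda>(a', b'). (a' - a) / (b - b')) `
    ({z. poly (cpoly p) z = 0} \<times> {z. poly (cpoly q) z = 0})"
  have "finite bad"
    unfolding bad_def using p0 by (intro finite_imageI finite_cartesian_product poly_roots_finite) auto
  moreover have "infinite (range (of_rat :: rat \<Rightarrow> complex))"
    using finite_imageD[of "of_rat :: rat \<Rightarrow> complex" UNIV] infinite_UNIV_char_0[where 'a = rat]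
    by (auto simp: inj_def)
  ultimately obtain c where c: "of_rat c \<notin> bad"
    by (meson finite_subset image_subsetI)
  define \<gamma> where "\<gamma> = a + of_rat c * b"
  define K where "K = Q_adjoin \<gamma>"
  have K: "subfield_C K"
    unfolding K_def \<gamma>_def by (rule subfield_Q_adjoin[OF alg])
  have \<gamma>K: "\<gamma> \<in> K" by (simp add: K_def Q_adjoin_self)
  \<comment> \<open>At z this takes the value of p at \<gamma> - c z, so it has coefficients in K
    and vanishes at b.\<close>
  define P where "P = pcompose (cpoly p) [:\<gamma>, - of_rat c:]"
  have PK: "coeff P i \<in> K" for i
    unfolding P_def
    by (rule subfield_coeff_pcompose[OF K])
      (auto simp: coeff_pCons subfield_of_rat[OF K] subfield_uminus[OF K] subfield_0[OF K] \<gamma>K split: nat.split)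
  have Pb: "poly P b = 0"
    using p by (simp add: P_def poly_pcompose \<gamma>_def algebra_simps)
  \<comment> \<open>A polynomial of least degree with this property is, up to a scalar, the minimal
    polynomial of b over K, so it divides both \<open>cpoly q\<close> and \<open>P\<close>.\<close>
  define M where "M h \<longleftrightarrow> (\<forall>i. coeff h i \<in> K) \<and> h \<noteq> 0 \<and> poly h b = 0" for h
  have "M (cpoly q)"
    using q p0 by (auto simp: M_def subfield_of_rat[OF K])
  then obtain h where h: "M h" and hmin: "\<And>g. M g \<Longrightarrow> degree h \<le> degree g"
    using ex_has_least_nat[of M _ degree] by blast
  have hdvd: "h dvd f" if "\<And>i. coeff f i \<in> K" "poly f b = 0" for f
    by (rule minimal_degree_dvd[OF K, where x = b]) (use that h hmin in \<open>auto simp: M_def\<close>)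
  have hq: "h dvd cpoly q"
    by (rule hdvd) (use q in \<open>auto simp: subfield_of_rat[OF K]\<close>)
  have hP: "h dvd P"
    by (rule hdvd) (use PK Pb in auto)
  have "{z. poly h z = 0} = {b}"
  proof (intro equalityI subsetI)
    fix z assume "z \<in> {z. poly h z = 0}"
    then have z: "poly (cpoly q) z = 0" "poly P z = 0"
      using hq hP by (auto elim!: dvdE)
    have "poly (cpoly p) (\<gamma> - of_rat c * z) = 0"
      using z(2) by (simp add: P_def poly_pcompose algebra_simps)
    then have "((\<gamma> - of_rat c * z) - a) / (b - z) \<in> bad"
      using z(1) unfolding bad_def by force
    moreover have "((\<gamma> - of_rat c * z) - a) / (b - z) = of_rat c" if "z \<noteq> b"
      using that by (simp add: \<gamma>_def field_simps)
    ultimately show "z \<in> {b}" using c by (metis singletonI)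
  qed (use h in \<open>auto simp: M_def\<close>)
  \<comment> \<open>Root multiplicities of a divisor are bounded by those of \<open>cpoly q\<close>,
    which is squarefree.\<close>
  moreover have "rsquarefree h"
  proof -
    have "order z h \<le> order z (cpoly q)" for z
      using hq p0 by (intro dvd_imp_order_le) auto
    moreover have "order z (cpoly q) \<le> 1" for z
      using irreducible_rsquarefree[OF q(1)] unfolding rsquarefree_def by (metis le_refl zero_le_one)
    ultimately show ?thesis
      using h unfolding rsquarefree_def M_def
      by (metis One_nat_def le_SucE le_zero_eq order_trans)
  qed
  ultimately have deg_h: "degree h = 1"
    using card_roots_rsquarefree[of h] by simp
  define u v where "u = coeff h 0" and "v = coeff h 1"
  have "v \<noteq> 0" using deg_h leading_coeff_0_iff[of h] by (auto simp: v_def)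
  moreover have "poly h b = u + v * b"
    using deg_h by (simp add: poly_altdef u_def v_def)
  ultimately have "b = (- u) / v"
    using h by (simp add: M_def field_simps eq_neg_iff_add_eq_0)
  moreover have "u \<in> K" "v \<in> K"
    using h by (auto simp: M_def u_def v_def)
  ultimately have bK: "b \<in> K"
    using subfield_divide[OF K] subfield_uminus[OF K] by blast
  have "a = \<gamma> - of_rat c * b" by (simp add: \<gamma>_def)
  then have "a \<in> K"
    using bK \<gamma>K subfield_diff[OF K] subfield_mult[OF K] subfield_of_rat[OF K] by metis
  then show ?thesis using bK that by (simp add: K_def \<gamma>_def)
qed

text \<open>If x were transcendental, its first \<open>card B + 1\<close> powers would be distinct
  and independent over Q, yet they lie in the rational span of B.\<close>

lemma finite_over_Q_algebraic:
  assumes E: "subfield_C E" and fin: "finite_over_Q E" and x: "x \<in> E"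
  shows "algebraic_Q x"
proof (rule ccontr)
  assume nalg: "\<not> algebraic_Q x"
  interpret Q: vector_space "\<lambda>q z. of_rat q * z :: complex"
    by unfold_locales (auto simp: algebra_simps of_rat_add of_rat_mult)
  obtain B where B: "finite B" "\<forall>x\<in>E. \<exists>q :: complex \<Rightarrow> rat. x = (\<Sum>b\<in>B. of_rat (q b) * b)"
    using fin by (auto simp: finite_over_Q_def)
  have span: "E \<subseteq> Q.span B"
    using B(2) by (fastforce intro: Q.span_sum Q.span_scale Q.span_base)
  define n where "n = Suc (card B)"
  have zero: "p = 0" if "poly (cpoly p) x = 0" for p
    using nalg that by (auto simp: algebraic_Q_def)
  have inj: "inj_on (\<lambda>i. x ^ i) {..<n}"
  proof (rule inj_onI)
    fix i j assume "x ^ i = x ^ j"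
    then have "poly (cpoly (monom 1 i - monom 1 j)) x = 0"
      by (simp add: map_poly_monom poly_monom)
    then have "monom 1 i = (monom 1 j :: rat poly)" using zero by fastforce
    then show "i = j" by (metis degree_monom_eq one_neq_zero)
  qed
  have "Q.independent ((\<lambda>i. x ^ i) ` {..<n})"
  proof (rule Q.independent_if_scalars_zero)
    fix g y assume s: "(\<Sum>y\<in>(\<lambda>i. x ^ i) ` {..<n}. of_rat (g y) * y) = 0"
      and y: "y \<in> (\<lambda>i. x ^ i) ` {..<n}"
    define p where "p = (\<Sum>i<n. monom (g (x ^ i)) i)"
    have cp: "cpoly p = (\<Sum>i<n. monom (of_rat (g (x ^ i))) i)"
      by (rule poly_eqI) (simp add: p_def coeff_sum of_rat_sum if_distrib cong: if_cong)
    have "poly (cpoly p) x = 0"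
      using s by (simp add: cp poly_sum poly_monom sum.reindex[OF inj])
    then have "p = 0" by (rule zero)
    moreover obtain i where "i < n" "y = x ^ i" using y by auto
    moreover have "coeff p i = g (x ^ i)" if "i < n" for i
      using that by (simp add: p_def coeff_sum)
    ultimately show "g y = 0" by auto
  qed auto
  moreover have "(\<lambda>i. x ^ i) ` {..<n} \<subseteq> Q.span B"
    using span x subfield_power[OF E] by auto
  ultimately have "card ((\<lambda>i. x ^ i) ` {..<n}) \<le> card B"
    using Q.independent_span_bound[OF B(1)] by blast
  then show False
    using card_image[OF inj] by (simp add: n_def)
qed

text \<open>The elements of a finite spanning set are absorbed one at a time into a single element
  of E. Catching that set suffices, as \<open>Q_adjoin \<theta>\<close> is closed under rational
  combinations.\<close>

lemma primitive_element:
  assumes E: "subfield_C E" and fin: "finite_over_Q E"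
  obtains \<theta> where "\<theta> \<in> E" "E = Q_adjoin \<theta>"
proof -
  note alg = finite_over_Q_algebraic[OF E fin]
  have "\<exists>\<theta>\<in>E. B \<subseteq> Q_adjoin \<theta>" if "finite B" "B \<subseteq> E" for B
    using that
  proof (induction B rule: finite_induct)
    case empty
    then show ?case using subfield_0[OF E] by blast
  next
    case (insert b B)
    then obtain \<theta> where \<theta>: "\<theta> \<in> E" "B \<subseteq> Q_adjoin \<theta>" by auto
    have in_E: "\<theta> + of_rat c * b \<in> E" for c
      using \<theta> insert.prems by (auto intro!: subfield_add subfield_mult subfield_of_rat E)
    obtain c where "\<theta> \<in> Q_adjoin (\<theta> + of_rat c * b)" "b \<in> Q_adjoin (\<theta> + of_rat c * b)"
      using Q_adjoin_two[of \<theta> b] alg \<theta>(1) in_E insert.prems by auto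
    then have "insert b B \<subseteq> Q_adjoin (\<theta> + of_rat c * b)"
      using \<theta>(2) Q_adjoin_subset by blast
    then show ?case using in_E by blast
  qed
  moreover obtain B where B: "finite B" "B \<subseteq> E"
    "\<forall>x\<in>E. \<exists>q :: complex \<Rightarrow> rat. x = (\<Sum>b\<in>B. of_rat (q b) * b)"
    using fin by (auto simp: finite_over_Q_def)
  ultimately obtain \<theta> where \<theta>: "\<theta> \<in> E" "B \<subseteq> Q_adjoin \<theta>" by blast
  have K: "subfield_C (Q_adjoin \<theta>)"
    by (rule subfield_Q_adjoin[OF alg[OF \<theta>(1)]])
  have "E \<subseteq> Q_adjoin \<theta>"
  proof
    fix x assume "x \<in> E"
    then obtain q where x: "x = (\<Sum>b\<in>B. of_rat (q b :: rat) * b)" using B(3) by blast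
    show "x \<in> Q_adjoin \<theta>"
      unfolding x by (intro subfield_sum[OF K] subfield_mult[OF K] subfield_of_rat[OF K]) (use \<theta>(2) in auto)
  qed
  moreover have "Q_adjoin \<theta> \<subseteq> E"
    using subfield_poly_cpoly[OF E \<theta>(1)] by (auto simp: Q_adjoin_def)
  ultimately show ?thesis using \<theta>(1) that by blast
qed

section \<open>The Galois group\<close>

context
  fixes E :: "complex set" and \<sigma> :: "complex \<Rightarrow> complex"
  assumes E: "subfield_C E" and \<sigma>: "\<sigma> \<in> Gal E"
begin

lemma Gal_in: "x \<in> E \<Longrightarrow> \<sigma> x \<in> E"
  using \<sigma> by (auto simp: Gal_def bij_betw_def)

lemma Gal_add: "x \<in> E \<Longrightarrow> y \<in> E \<Longrightarrow> \<sigma> (x + y) = \<sigma> x + \<sigma> y"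
  and Gal_mult: "x \<in> E \<Longrightarrow> y \<in> E \<Longrightarrow> \<sigma> (x * y) = \<sigma> x * \<sigma> y"
  and Gal_1: "\<sigma> 1 = 1"
  using \<sigma> by (auto simp: Gal_def)

lemma Gal_0: "\<sigma> 0 = 0"
  using Gal_add[of 0 0] subfield_0[OF E] by simp

lemma Gal_uminus: "x \<in> E \<Longrightarrow> \<sigma> (- x) = - \<sigma> x"
  using Gal_add[of x "- x"] subfield_uminus[OF E] Gal_0 by (simp add: eq_neg_iff_add_eq_0 add.commute)

lemma Gal_sum: "(\<And>i. i \<in> I \<Longrightarrow> g i \<in> E) \<Longrightarrow> \<sigma> (sum g I) = (\<Sum>i\<in>I. \<sigma> (g i))"
  by (induction I rule: infinite_finite_induct) (auto simp: Gal_0 Gal_add subfield_sum[OF E])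

lemma Gal_power: "x \<in> E \<Longrightarrow> \<sigma> (x ^ n) = \<sigma> x ^ n"
  by (induction n) (auto simp: Gal_1 Gal_mult subfield_power[OF E])

lemma Gal_of_nat: "\<sigma> (of_nat n) = of_nat n"
  by (induction n) (auto simp: Gal_0 Gal_1 Gal_add subfield_of_nat[OF E] subfield_1[OF E])

lemma Gal_of_int: "\<sigma> (of_int k) = of_int k"
  by (cases k rule: int_cases2) (auto simp: Gal_of_nat Gal_uminus subfield_of_nat[OF E])

lemma Gal_of_rat: "\<sigma> (of_rat q) = of_rat q"
proof -
  obtain a b where ab: "quotient_of q = (a, b)" by fastforce
  then have b: "b \<noteq> 0" using quotient_of_denom_pos by fastforce
  have q: "q = of_int a / of_int b" using ab by (rule quotient_of_div)
  then have "of_rat q * of_int b = (of_int a :: complex)"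
    using b by (simp add: of_rat_divide)
  then have "\<sigma> (of_rat q) * of_int b = of_int a"
    using Gal_mult[OF subfield_of_rat[OF E] subfield_of_int[OF E], of q b] by (simp add: Gal_of_int)
  also have "\<dots> = of_rat q * of_int b"
    using b q by (simp add: of_rat_divide)
  finally show ?thesis
    using b by simp
qed

lemma Gal_poly_cpoly: "x \<in> E \<Longrightarrow> \<sigma> (poly (cpoly g) x) = poly (cpoly g) (\<sigma> x)"
  unfolding poly_altdef
  by (simp add: Gal_sum Gal_mult Gal_power Gal_of_rat subfield_of_rat[OF E] subfield_mult[OF E] subfield_power[OF E])

text \<open>The convention that \<sigma> is the identity off E makes it a permutation of all complex
  numbers, so that the global \<open>inv\<close> is the group inverse.\<close>

lemma Gal_bij: "bij \<sigma>"
proof -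
  have "bij_betw \<sigma> (- E) (- E)"
    using \<sigma> bij_betw_cong[of "- E" \<sigma> id] by (auto simp: Gal_def)
  then have "bij_betw \<sigma> (E \<union> - E) (E \<union> - E)"
    using \<sigma> by (intro bij_betw_combine) (auto simp: Gal_def)
  then show ?thesis by simp
qed

lemma Gal_inv: "inv \<sigma> \<in> Gal E"
proof -
  have inj: "inj \<sigma>" and surj: "surj \<sigma>" using Gal_bij by (auto simp: bij_def)
  have im: "\<sigma> ` E = E" using \<sigma> by (auto simp: Gal_def bij_betw_def)
  have inv_E: "inv \<sigma> x \<in> E" if "x \<in> E" for x
    using that im inj by (metis imageE inv_f_f)
  have "inv \<sigma> ` E = E"
    using im inj by (metis image_inv_f_f)
  moreover have "inj_on (inv \<sigma>) E"
    using surj by (simp add: inj_on_inv_into)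
  moreover have "inv \<sigma> (x + y) = inv \<sigma> x + inv \<sigma> y" "inv \<sigma> (x * y) = inv \<sigma> x * inv \<sigma> y"
    if "x \<in> E" "y \<in> E" for x y
    using that inv_E inj surj
    by (auto intro!: inv_f_eq simp: Gal_add Gal_mult surj_f_inv_f)
  moreover have "inv \<sigma> 1 = 1"
    using Gal_1 inj by (metis inv_f_f)
  moreover have "inv \<sigma> z = z" if "z \<notin> E" for z
    using that \<sigma> inj by (auto simp: Gal_def intro!: inv_f_eq)
  ultimately show ?thesis by (auto simp: Gal_def bij_betw_def)
qed

end

section \<open>Group structure, and automorphisms as conjugates of a primitive element\<close>

lemma Gal_id: "id \<in> Gal E"
  by (simp add: Gal_def)

lemma Gal_comp:
  assumes "subfield_C E" "\<sigma> \<in> Gal E" "\<tau> \<in> Gal E"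
  shows "\<sigma> \<circ> \<tau> \<in> Gal E"
proof -
  have "bij_betw (\<sigma> \<circ> \<tau>) E E"
    using assms by (auto simp: Gal_def intro: bij_betw_trans)
  moreover have "\<forall>z. z \<notin> E \<longrightarrow> (\<sigma> \<circ> \<tau>) z = z"
    using assms by (auto simp: Gal_def)
  moreover have "(\<sigma> \<circ> \<tau>) (x + y) = (\<sigma> \<circ> \<tau>) x + (\<sigma> \<circ> \<tau>) y"
    "(\<sigma> \<circ> \<tau>) (x * y) = (\<sigma> \<circ> \<tau>) x * (\<sigma> \<circ> \<tau>) y" if "x \<in> E" "y \<in> E" for x y
    using that by (simp_all add: Gal_add[OF assms(1,2)] Gal_add[OF assms(1,3)]
      Gal_mult[OF assms(1,2)] Gal_mult[OF assms(1,3)] Gal_in[OF assms(1,3)])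
  moreover have "(\<sigma> \<circ> \<tau>) 1 = 1"
    by (simp add: Gal_1[OF assms(1,2)] Gal_1[OF assms(1,3)])
  ultimately show ?thesis unfolding Gal_def by blast
qed

lemma Gal_eqI:
  assumes "subfield_C E" "E = Q_adjoin \<theta>" "\<theta> \<in> E" "\<sigma> \<in> Gal E" "\<tau> \<in> Gal E" "\<sigma> \<theta> = \<tau> \<theta>"
  shows "\<sigma> = \<tau>"
proof
  fix x
  show "\<sigma> x = \<tau> x"
  proof (cases "x \<in> E")
    case True
    then obtain g where "x = poly (cpoly g) \<theta>" using assms(2) by (auto simp: Q_adjoin_def)
    then show ?thesis
      by (simp add: Gal_poly_cpoly[OF assms(1,4,3)] Gal_poly_cpoly[OF assms(1,5,3)] assms(6))
  qed (use assms in \<open>auto simp: Gal_def\<close>)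
qed

text \<open>An automorphism is determined by the image of \<theta>, and this image is a root of any
  rational polynomial killing \<theta>.\<close>

lemma finite_Gal:
  assumes "subfield_C E" "finite_over_Q E"
  shows "finite (Gal E)"
proof -
  obtain \<theta> where \<theta>: "\<theta> \<in> E" "E = Q_adjoin \<theta>"
    using primitive_element[OF assms] .
  obtain p where p: "p \<noteq> 0" "poly (cpoly p) \<theta> = 0"
    using finite_over_Q_algebraic[OF assms \<theta>(1)] by (auto simp: algebraic_Q_def)
  have "(\<lambda>\<sigma>. \<sigma> \<theta>) ` Gal E \<subseteq> {z. poly (cpoly p) z = 0}"
  proof clarify
    fix \<sigma> assume "\<sigma> \<in> Gal E"
    then have "poly (cpoly p) (\<sigma> \<theta>) = \<sigma> (poly (cpoly p) \<theta>)"
      using Gal_poly_cpoly[OF assms(1) _ \<theta>(1)] by simp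
    then show "poly (cpoly p) (\<sigma> \<theta>) = 0"
      using p Gal_0[OF assms(1) \<open>\<sigma> \<in> Gal E\<close>] by simp
  qed
  moreover have "finite {z. poly (cpoly p) z = 0}"
    using p by (intro poly_roots_finite) simp
  moreover have "inj_on (\<lambda>\<sigma>. \<sigma> \<theta>) (Gal E)"
    using Gal_eqI[OF assms(1) \<theta>(2,1)] by (auto intro: inj_onI)
  ultimately show ?thesis
    using finite_imageD finite_subset by blast
qed

text \<open>The automorphism sends g(\<theta>) to g(z), which is independent of the choice of g
  because \<theta> and z are zeros of the same rational polynomials. Normality places z, hence every
  value, in E.\<close>

lemma Gal_extend:
  assumes E: "subfield_C E" "finite_over_Q E" "normal_over_Q E"
    and \<theta>: "\<theta> \<in> E" "E = Q_adjoin \<theta>"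
    and p: "irreducible p" "poly (cpoly p) \<theta> = 0" "poly (cpoly p) z = 0"
  obtains \<sigma> where "\<sigma> \<in> Gal E" "\<sigma> \<theta> = z"
proof -
  have to_z: "poly (cpoly g) z = 0" if "poly (cpoly g) \<theta> = 0" for g
    by (rule irreducible_conjugate_roots[OF p that])
  have of_z: "poly (cpoly g) \<theta> = 0" if "poly (cpoly g) z = 0" for g
    by (rule irreducible_conjugate_roots[OF p(1,3,2) that])
  have zE: "z \<in> E"
    using E(3) \<theta>(1) to_z unfolding normal_over_Q_def by blast
  define \<sigma> where "\<sigma> x = (if x \<in> E then poly (cpoly (SOME g. x = poly (cpoly g) \<theta>)) z else x)" for x
  have \<sigma>: "\<sigma> (poly (cpoly g) \<theta>) = poly (cpoly g) z" for g
  proof -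
    define g' where "g' = (SOME g'. poly (cpoly g) \<theta> = poly (cpoly g') \<theta>)"
    have "poly (cpoly g) \<theta> = poly (cpoly g') \<theta>"
      unfolding g'_def by (rule someI) (rule refl)
    then have "poly (cpoly (g - g')) z = 0"
      by (intro to_z) simp
    moreover have "poly (cpoly g) \<theta> \<in> E"
      using \<theta>(2) by (auto intro: Q_adjoinI)
    ultimately show ?thesis
      by (simp add: \<sigma>_def flip: g'_def)
  qed
  have rep: "\<exists>g. x = poly (cpoly g) \<theta>" if "x \<in> E" for x
    using that \<theta>(2) by (auto simp: Q_adjoin_def)
  have add_mult: "\<sigma> (x + y) = \<sigma> x + \<sigma> y \<and> \<sigma> (x * y) = \<sigma> x * \<sigma> y" if xy: "x \<in> E" "y \<in> E" for x y
  proof -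
    obtain g h where gh: "x = poly (cpoly g) \<theta>" "y = poly (cpoly h) \<theta>"
      using rep xy by blast
    show ?thesis
      using \<sigma>[of g] \<sigma>[of h] \<sigma>[of "g + h"] \<sigma>[of "g * h"] by (simp add: gh)
  qed
  have one: "\<sigma> 1 = 1" using \<sigma>[of 1] by simp
  have in_E: "\<sigma> x \<in> E" if x: "x \<in> E" for x
    using rep[OF x] \<sigma> subfield_poly_cpoly[OF E(1) zE] by auto
  have inj: "inj_on \<sigma> E"
  proof (rule inj_onI)
    fix x y assume xy: "x \<in> E" "y \<in> E" "\<sigma> x = \<sigma> y"
    obtain g h where gh: "x = poly (cpoly g) \<theta>" "y = poly (cpoly h) \<theta>"
      using rep xy by blast
    have "poly (cpoly (g - h)) z = 0"
      using xy(3) by (simp add: gh \<sigma>)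
    then have "poly (cpoly (g - h)) \<theta> = 0" by (rule of_z)
    then show "x = y" by (simp add: gh)
  qed
  have "E \<subseteq> \<sigma> ` E"
  proof
    \<comment> \<open>An injective map permutes the finite set of roots in \<open>E\<close> of a rational polynomial.\<close>
    fix y assume y: "y \<in> E"
    then obtain q where q: "q \<noteq> 0" "poly (cpoly q) y = 0"
      using finite_over_Q_algebraic[OF E(1,2)] by (auto simp: algebraic_Q_def)
    define R where "R = {x \<in> E. poly (cpoly q) x = 0}"
    have "finite {x. poly (cpoly q) x = 0}"
      using q by (intro poly_roots_finite) simp
    then have "finite R" by (rule rev_finite_subset) (auto simp: R_def)
    moreover have "\<sigma> ` R \<subseteq> R"
    proof clarify
      fix x assume "x \<in> R"
      then have x: "x \<in> E" "poly (cpoly q) x = 0" by (auto simp: R_def)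
      then obtain g where g: "x = poly (cpoly g) \<theta>" using rep by blast
      have "poly (cpoly (pcompose q g)) z = 0"
        by (rule to_z) (use x g in \<open>simp add: cpoly_pcompose poly_pcompose\<close>)
      then show "\<sigma> x \<in> R"
        using in_E[OF x(1)] by (simp add: R_def g \<sigma> cpoly_pcompose poly_pcompose)
    qed
    moreover have "inj_on \<sigma> R"
      by (rule inj_on_subset[OF inj]) (auto simp: R_def)
    ultimately have "\<sigma> ` R = R" by (rule endo_inj_surj)
    then show "y \<in> \<sigma> ` E" using y q by (auto simp: R_def)
  qed
  then have "bij_betw \<sigma> E E"
    using inj in_E by (auto simp: bij_betw_def)
  then have "\<sigma> \<in> Gal E"
    using add_mult one by (auto simp: Gal_def \<sigma>_def)
  moreover have "\<sigma> \<theta> = z" using \<sigma>[of "[:0, 1:]"] by simp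
  ultimately show ?thesis by (rule that)
qed

text \<open>Write x = g(\<theta>) with g of degree below that of p. As x is fixed, g takes the value
  x at every conjugate of \<theta>. There are as many conjugates as the degree of p, so g - x is
  zero and x is the constant coefficient of g.\<close>

lemma Gal_fixed_rational:
  assumes E: "subfield_C E" "finite_over_Q E" "normal_over_Q E"
    and x: "x \<in> E" "\<And>\<sigma>. \<sigma> \<in> Gal E \<Longrightarrow> \<sigma> x = x"
  obtains q where "x = of_rat q"
proof -
  obtain \<theta> where \<theta>: "\<theta> \<in> E" "E = Q_adjoin \<theta>"
    using primitive_element[OF E(1,2)] .
  obtain p where p: "irreducible p" "poly (cpoly p) \<theta> = 0"
    using finite_over_Q_algebraic[OF E(1,2) \<theta>(1)] algebraic_Q_irreducibleE by blast
  have p0: "p \<noteq> 0" "degree p \<noteq> 0"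
    using p(1) is_unit_iff_degree[of p] by (auto simp: irreducible_def)
  obtain g0 where g0: "x = poly (cpoly g0) \<theta>"
    using x(1) \<theta>(2) by (auto simp: Q_adjoin_def)
  define g where "g = g0 mod p"
  have "x = poly (cpoly (g0 div p * p + g)) \<theta>"
    by (simp add: g_def g0)
  then have g: "x = poly (cpoly g) \<theta>"
    using p by simp
  have deg_g: "degree g < degree p"
    using p0 degree_mod_less'[of p g0] by (cases "g = 0") (auto simp: g_def)
  define h where "h = cpoly g - [:x:]"
  have "{z. poly (cpoly p) z = 0} \<subseteq> {z. poly h z = 0}"
  proof clarify
    fix z assume "poly (cpoly p) z = 0"
    then obtain \<sigma> where \<sigma>: "\<sigma> \<in> Gal E" "\<sigma> \<theta> = z"
      using Gal_extend[OF E \<theta> p] by blast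
    have "x = \<sigma> x" using x(2)[OF \<sigma>(1)] by simp
    also have "\<dots> = poly (cpoly g) z"
      using Gal_poly_cpoly[OF E(1) \<sigma>(1) \<theta>(1)] \<sigma>(2) g by simp
    finally show "poly h z = 0" by (simp add: h_def)
  qed
  then have card_le: "degree p \<le> card {z. poly h z = 0}" if "h \<noteq> 0"
    using card_mono[OF poly_roots_finite[OF that]]
      card_roots_rsquarefree[OF irreducible_rsquarefree[OF p(1)]] by (metis degree_cpoly)
  have "degree h < degree p"
    unfolding h_def by (rule degree_diff_less) (use deg_g p0 in auto)
  then have "h = 0"
    using card_le card_poly_roots_bound[of h] by fastforce
  then have "coeff (cpoly g) 0 = x" by (simp add: h_def)
  then show ?thesis using that[of "coeff g 0"] by simp
qed

section \<open>Integrality of the characteristic polynomial\<close>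

abbreviation qpoly :: "int poly \<Rightarrow> rat poly" where
  "qpoly \<equiv> map_poly of_int"

lemma qpoly_coeff [simp]: "coeff (qpoly p) i = of_int (coeff p i)"
  by (simp add: coeff_map_poly)

lemma qpoly_mult: "qpoly (p * q) = qpoly p * qpoly q"
  by (rule poly_eqI) (simp add: coeff_mult)

lemma qpoly_smult: "qpoly (smult a p) = smult (of_int a) (qpoly p)"
  by (rule poly_eqI) simp

lemma qpoly_inj: "qpoly p = qpoly q \<Longrightarrow> p = q"
  by (simp add: poly_eq_iff)

lemma cpoly_qpoly: "cpoly (qpoly p) = map_poly of_int p"
  by (rule poly_eqI) (simp add: coeff_map_poly)

lemma rat_poly_common_denominator:
  fixes g :: "rat poly"
  shows "\<exists>a G. a \<noteq> 0 \<and> smult (of_int a) g = qpoly G"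
proof (induction g)
  case 0
  show ?case by (rule exI[of _ 1], rule exI[of _ 0]) simp
next
  case (pCons x g)
  then obtain a G where G: "a \<noteq> 0" "smult (of_int a) g = qpoly G" by blast
  obtain u v where uv: "quotient_of x = (u, v)" by fastforce
  have v: "v \<noteq> 0" using quotient_of_denom_pos[OF uv] by simp
  have x: "x = of_int u / of_int v" by (rule quotient_of_div[OF uv])
  have "smult (of_int (a * v)) (pCons x g) = pCons (of_int (a * u)) (smult (of_int v) (smult (of_int a) g))"
    using v by (simp add: x mult.commute)
  also have "\<dots> = qpoly (pCons (a * u) (smult v G))"
    unfolding G(2) by (simp add: map_poly_pCons qpoly_smult)
  finally show ?case using G(1) v by (metis mult_eq_0_iff)
qed

lemma rat_poly_primitive:
  fixes g :: "rat poly"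
  assumes "g \<noteq> 0"
  obtains r G where "content G = 1" "g = smult r (qpoly G)"
proof -
  obtain a H where H: "a \<noteq> 0" "smult (of_int a) g = qpoly H"
    using rat_poly_common_denominator by blast
  have "H \<noteq> 0" using H assms by auto
  have "smult (of_int a) g = smult (of_int (content H)) (qpoly (primitive_part H))"
    unfolding H(2) by (simp flip: qpoly_smult)
  then have "smult (1 / of_int a) (smult (of_int a) g) =
      smult (of_int (content H) / of_int a) (qpoly (primitive_part H))"
    by simp
  then have "g = smult (of_int (content H) / of_int a) (qpoly (primitive_part H))"
    using H(1) by simp
  then show ?thesis using that \<open>H \<noteq> 0\<close> content_primitive_part by blast
qed

text \<open>Write g = r G and the cofactor h = s H with G, H primitive. Multiplicativity of the
  content forces r s to have absolute value 1, so the leading coefficients of G and H have a unit as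
  product; monicity of g then gives r = 1 or r = -1.\<close>

lemma monic_dvd_int_poly:
  fixes g :: "rat poly"
  assumes g: "lead_coeff g = 1" and P: "lead_coeff P = 1" and dvd: "g dvd qpoly P"
  shows "coeff g k \<in> \<int>"
proof -
  obtain h where h: "qpoly P = g * h" using dvd by (auto elim: dvdE)
  have degP: "degree (qpoly P) = degree P" by (rule degree_map_poly) simp
  have "lead_coeff (qpoly P) = 1" using P degP by simp
  then have lch: "lead_coeff h = 1" using g h by (simp add: lead_coeff_mult)
  have "g \<noteq> 0" "h \<noteq> 0" using g lch by auto
  then obtain r G s H where G: "content G = 1" "g = smult r (qpoly G)"
    and H: "content H = 1" "h = smult s (qpoly H)"
    using rat_poly_primitive by metis
  have PGH: "qpoly P = smult (r * s) (qpoly (G * H))"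
    using h G H by (simp add: qpoly_mult mult_ac)
  obtain u v where uv: "quotient_of (r * s) = (u, v)" by fastforce
  have v: "v > 0" using quotient_of_denom_pos[OF uv] .
  have rs: "r * s = of_int u / of_int v" by (rule quotient_of_div[OF uv])
  have "qpoly (smult v P) = qpoly (smult u (G * H))"
    unfolding qpoly_smult PGH rs using v by simp
  then have "smult v P = smult u (G * H)" by (rule qpoly_inj)
  then have "content (smult v P) = content (smult u (G * H))" by simp
  moreover have "content P = 1"
    using P content_dvd_coeff[of P "degree P"] by (metis is_unit_content_iff)
  ultimately have "v = \<bar>u\<bar>"
    using v G H by (simp add: content_mult)
  then have rs1: "\<bar>r * s\<bar> = 1" using rs v by simp
  have "r * of_int (lead_coeff G) = 1"
    using g G by (auto simp: degree_map_poly split: if_splits)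
  moreover have "s * of_int (lead_coeff H) = 1"
    using lch H by (auto simp: degree_map_poly split: if_splits)
  ultimately have "r * s * of_int (lead_coeff G * lead_coeff H) = 1"
    by (simp add: algebra_simps) (metis mult.assoc mult.commute mult.right_neutral)
  then have "\<bar>of_int (lead_coeff G * lead_coeff H) :: rat\<bar> = 1"
    using rs1 by (metis abs_mult abs_one mult_1)
  then have "\<bar>lead_coeff G * lead_coeff H\<bar> = 1"
    by linarith
  then have "\<bar>lead_coeff G\<bar> = 1"
    by (metis abs_zmult_eq_1)
  then have "r = 1 \<or> r = - 1"
    using \<open>r * of_int (lead_coeff G) = 1\<close> by (auto simp: abs_if split: if_splits)
  then show ?thesis using G(2) by auto
qed

text \<open>Peel off the minimal polynomial of a root z. It divides the integer polynomial
  witnessing that z is an algebraic integer, hence is integral by Gauss's lemma, and the quotient is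
  a monic polynomial of smaller degree of the same kind. Sums and products of algebraic integers
  never have to be considered.\<close>

lemma monic_algebraic_int_roots:
  fixes g :: "rat poly"
  assumes "lead_coeff g = 1" and "\<And>z. poly (cpoly g) z = 0 \<Longrightarrow> algebraic_int z"
  shows "coeff g k \<in> \<int>"
  using assms
proof (induction "degree g" arbitrary: g k rule: less_induct)
  case less
  show ?case
  proof (cases "degree g = 0")
    case True
    then have "g = 1"
      using less.prems(1) by (metis degree_0_id lead_coeff_pCons(1) one_pCons degree_eq_zeroE)
    then show ?thesis by (simp add: coeff_1)
  next
    case False
    then obtain z where z: "poly (cpoly g) z = 0"
      by (metis constant_degree degree_cpoly fundamental_theorem_of_algebra)
    then obtain P :: "int poly" where P: "lead_coeff P = 1" "poly (map_poly of_int P) z = 0"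
      using less.prems(2) by (auto simp: algebraic_int_def)
    have "algebraic_Q z"
      unfolding algebraic_Q_def using z less.prems(1) by (metis leading_coeff_0_iff one_neq_zero)
    then obtain q0 where q0: "irreducible q0" "poly (cpoly q0) z = 0"
      by (rule algebraic_Q_irreducibleE)
    have q0_nz: "q0 \<noteq> 0" "degree q0 \<noteq> 0"
      using q0(1) is_unit_iff_degree[of q0] by (auto simp: irreducible_def)
    define q where "q = smult (inverse (lead_coeff q0)) q0"
    have q: "lead_coeff q = 1" using q0_nz by (simp add: q_def)
    have "q dvd g" "q dvd qpoly P"
      using irreducible_dvd_of_common_root[OF q0, of g] irreducible_dvd_of_common_root[OF q0, of "qpoly P"]
        z P q0_nz by (auto simp: q_def cpoly_qpoly intro!: smult_dvd)
    then obtain h where h: "g = q * h" by (auto elim: dvdE)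
    have qint: "coeff q i \<in> \<int>" for i
      by (rule monic_dvd_int_poly[OF q P(1) \<open>q dvd qpoly P\<close>])
    have lch: "lead_coeff h = 1"
      using less.prems(1) q by (simp add: h lead_coeff_mult)
    have "h \<noteq> 0" "q \<noteq> 0" using lch q by auto
    then have "degree h < degree g"
      using q0_nz by (simp add: h degree_mult_eq q_def)
    then have "coeff h i \<in> \<int>" for i
      using less.hyps less.prems(2) lch by (auto simp: h)
    then show ?thesis
      unfolding h coeff_mult using qint by (intro Ints_sum Ints_mult)
  qed
qed

text \<open>Serves three ring homomorphisms: evaluation of rational polynomials at a complex number,
  evaluation at 0, and the embedding of the rationals.\<close>

lemma det_hom:
  fixes h :: "'a::comm_ring_1 \<Rightarrow> 'b::comm_ring_1" and M :: "'a ^ 'n::finite ^ 'n"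
  assumes add: "\<And>x y. h (x + y) = h x + h y" and mult: "\<And>x y. h (x * y) = h x * h y"
    and one: "h 1 = 1"
  shows "h (det M) = det (\<chi> i j. h (M $ i $ j))"
proof -
  have zero: "h 0 = 0" using add[of 0 0] by simp
  have neg: "h (- x) = - h x" for x
    using add[of x "- x"] zero by (simp add: eq_neg_iff_add_eq_0 add.commute)
  have sum: "h (sum k S) = (\<Sum>x\<in>S. h (k x))" for k :: "('n \<Rightarrow> 'n) \<Rightarrow> 'a" and S
    by (induction S rule: infinite_finite_induct) (auto simp: zero add)
  have prod: "h (prod k S) = (\<Prod>x\<in>S. h (k x))" for k :: "'n \<Rightarrow> 'a" and S
    by (induction S rule: infinite_finite_induct) (auto simp: one mult)
  have sgn: "h (of_int (sign p)) = of_int (sign p)" for p :: "'n \<Rightarrow> 'n"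
    by (auto simp: sign_def one neg)
  show ?thesis
    unfolding det_def by (simp add: sum mult prod sgn)
qed

text \<open>In the Leibniz expansion the identity permutation contributes a monic product of
  \<open>CARD('n)\<close> linear factors. Any other permutation meets an off-diagonal entry, which
  is constant, so its term has smaller degree.\<close>

lemma lead_coeff_charpoly:
  fixes A :: "'a::idom ^ 'n::finite ^ 'n"
  shows "lead_coeff (charpoly A) = 1"
proof -
  define M :: "'n \<Rightarrow> 'n \<Rightarrow> 'a poly" where
    "M i j = (if i = j then [:0, 1:] else 0) - [:A $ i $ j:]" for i j
  define t where "t p = of_int (sign p) * (\<Prod>i\<in>UNIV. M i (p i))" for p :: "'n \<Rightarrow> 'n"
  define R where "R = (\<Sum>p\<in>{p. p permutes (UNIV :: 'n set)} - {id}. t p)"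
  have fin: "finite {p. p permutes (UNIV :: 'n set)}" by (rule finite_permutations) simp
  have "charpoly A = (\<Sum>p\<in>{p. p permutes (UNIV :: 'n set)}. t p)"
    by (simp add: charpoly_def det_def t_def M_def)
  also have "\<dots> = t id + R"
    unfolding R_def using fin by (intro sum.remove) (auto simp: permutes_id)
  finally have split: "charpoly A = t id + R" .
  have diag: "M i i = [:- (A $ i $ i), 1:]" for i by (simp add: M_def)
  have t_id: "t id = (\<Prod>i\<in>UNIV. M i i)" by (simp add: t_def sign_id)
  have deg_id: "degree (t id) = CARD('n)"
    unfolding t_id by (subst degree_prod_eq_sum_degree) (auto simp: diag)
  have lc_id: "lead_coeff (t id) = 1"
    unfolding t_id lead_coeff_prod by (simp add: diag)
  have "degree R < CARD('n)"
    unfolding R_def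
  proof (rule degree_sum_less)
    fix p assume "p \<in> {p. p permutes (UNIV :: 'n set)} - {id}"
    then obtain i0 where i0: "p i0 \<noteq> i0" by (metis DiffD2 eq_id_iff singletonI)
    have "degree (t p) \<le> degree (of_int (sign p) :: 'a poly) + degree (\<Prod>i\<in>UNIV. M i (p i))"
      unfolding t_def by (rule degree_mult_le)
    also have "\<dots> \<le> (\<Sum>i\<in>UNIV. degree (M i (p i)))"
      using degree_prod_sum_le[of UNIV "\<lambda>i. M i (p i)"] by (simp add: o_def)
    also have "\<dots> < (\<Sum>i\<in>(UNIV :: 'n set). 1)"
    proof (rule sum_strict_mono_ex1)
      show "\<forall>i\<in>UNIV. degree (M i (p i)) \<le> 1"
        by (auto simp: M_def)
      show "\<exists>i\<in>UNIV. degree (M i (p i)) < 1"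
        using i0 by (intro bexI[of _ i0]) (auto simp: M_def)
    qed simp
    finally show "degree (t p) < CARD('n)" by simp
  qed simp
  then have deg_lt: "degree R < degree (t id)" by (simp add: deg_id)
  then show ?thesis
    unfolding split by (metis lc_id degree_add_eq_left coeff_add coeff_eq_0 add.right_neutral)
qed

lemma eigenvalueI_det:
  fixes C :: "complex ^ 'n::finite ^ 'n"
  assumes "det (mat z - C) = 0"
  shows "eigenvalue C z"
proof -
  have "\<not> invertible (mat z - C)" using assms by (simp add: invertible_det_nz)
  then obtain v where v: "(mat z - C) *v v = 0" "v \<noteq> 0"
    using matrix_left_invertible_ker[of "mat z - C"] by (auto simp: invertible_left_inverse)
  have "mat z *v v = z *s v"
    by (simp add: vec_eq_iff matrix_vector_mult_def mat_def if_distrib[of "\<lambda>x. x * _"] cong: if_cong)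
  then have "C *v v = z *s v"
    using v(1) by (simp add: matrix_vector_mult_diff_rdistrib)
  then show ?thesis using v(2) by (auto simp: eigenvalue_def)
qed

lemma root_charpoly_eigenvalue:
  fixes A :: "rat ^ 'n::finite ^ 'n"
  assumes "poly (cpoly (charpoly A)) z = 0"
  shows "eigenvalue (ratmat A) z"
proof -
  have "poly (cpoly (charpoly A)) z = det (\<chi> i j. poly (cpoly
      ((\<chi> i j. (if i = j then [:0, 1:] else 0) - [:A $ i $ j:]) $ i $ j)) z)"
    unfolding charpoly_def by (rule det_hom[where h = "\<lambda>p. poly (cpoly p) z"]) auto
  also have "(\<chi> i j. poly (cpoly ((\<chi> i j. (if i = j then [:0, 1:] else 0) - [:A $ i $ j:]) $ i $ j)) z)
      = mat z - ratmat A"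
    by (simp add: vec_eq_iff mat_def ratmat_def)
  finally show ?thesis using assms by (intro eigenvalueI_det) simp
qed

text \<open>Evaluation at 0. The sign, a power of -1, is kept as a determinant because all that
  matters about it is that its square is 1.\<close>

lemma charpoly_coeff_0:
  fixes A :: "rat ^ 'n::finite ^ 'n"
  shows "coeff (charpoly A) 0 = det (mat (- 1) :: rat ^ 'n ^ 'n) * det A"
proof -
  have "poly (charpoly A) 0 = det (\<chi> i j. poly
      ((\<chi> i j. (if i = j then [:0, 1:] else 0) - [:A $ i $ j:]) $ i $ j) 0)"
    unfolding charpoly_def by (rule det_hom[where h = "\<lambda>p. poly p 0"]) auto
  also have "(\<chi> i j. poly ((\<chi> i j. (if i = j then [:0, 1:] else 0) - [:A $ i $ j:]) $ i $ j) 0)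
      = mat (- 1) ** A"
    by (simp add: vec_eq_iff mat_def matrix_matrix_mult_def if_distrib[of "\<lambda>x. x * _"] cong: if_cong)
  finally show ?thesis by (simp add: det_mul poly_0_coeff_0)
qed

lemma charpoly_integral:
  fixes A :: "rat ^ 'n::finite ^ 'n"
  assumes "\<And>z. eigenvalue (ratmat A) z \<Longrightarrow> algebraic_int z"
  shows "coeff (charpoly A) k \<in> \<int>"
  by (rule monic_algebraic_int_roots[OF lead_coeff_charpoly])
    (use assms root_charpoly_eigenvalue in blast)

lemma ratmat_mult: "ratmat (A ** B) = ratmat A ** ratmat B"
  by (simp add: vec_eq_iff ratmat_def matrix_matrix_mult_def of_rat_sum of_rat_mult)

lemma ratmat_mat_1: "ratmat (mat 1) = mat 1"
  by (simp add: vec_eq_iff ratmat_def mat_def)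

text \<open>Up to sign the determinant is the constant coefficient, an integer. Eigenvalues of the
  inverse matrix are inverses of eigenvalues of A, again algebraic integers by the unit condition,
  so the reciprocal of the determinant is an integer as well.\<close>

lemma integer_like_of_unit_eigenvalues:
  fixes A :: "rat ^ 'n::finite ^ 'n"
  assumes inv: "invertible A" and unit: "\<And>z. eigenvalue (ratmat A) z \<Longrightarrow> algebraic_unit z"
  shows "integer_like_Q A"
proof -
  obtain B where AB: "A ** B = mat 1" "B ** A = mat 1"
    using inv by (auto simp: invertible_def)
  have cAB: "ratmat A ** ratmat B = mat 1"
    using AB(1) by (simp add: ratmat_mat_1 flip: ratmat_mult)
  have A_int: "coeff (charpoly A) k \<in> \<int>" for k
    by (rule charpoly_integral) (use unit in \<open>auto simp: algebraic_unit_def\<close>)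
  have B_int: "coeff (charpoly B) k \<in> \<int>" for k
  proof (rule charpoly_integral)
    fix z assume "eigenvalue (ratmat B) z"
    then obtain v where v: "v \<noteq> 0" "ratmat B *v v = z *s v"
      by (auto simp: eigenvalue_def)
    have "v = ratmat A *v (ratmat B *v v)"
      by (simp add: matrix_vector_mul_assoc cAB)
    also have "\<dots> = z *s (ratmat A *v v)"
      unfolding v(2) by (simp add: vector_scalar_commute)
    finally have Av: "v = z *s (ratmat A *v v)" .
    then have z0: "z \<noteq> 0" using v(1) by auto
    have "inverse z *s v = ratmat A *v v"
      by (subst Av) (use z0 in \<open>simp add: vector_smult_assoc\<close>)
    then have "eigenvalue (ratmat A) (inverse z)"
      using v(1) by (auto simp: eigenvalue_def)
    then show "algebraic_int z"
      using unit by (fastforce simp: algebraic_unit_def)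
  qed
  define e where "e = det (mat (- 1) :: rat ^ 'n ^ 'n)"
  have ee: "e * e = 1"
  proof -
    have "mat (- 1) ** mat (- 1) = (mat 1 :: rat ^ 'n ^ 'n)"
      by (simp add: vec_eq_iff mat_def matrix_matrix_mult_def if_distrib[of "\<lambda>x. x * _"] cong: if_cong)
    then show ?thesis by (metis e_def det_mul det_I)
  qed
  have "det A * det B = 1" by (metis AB(1) det_mul det_I)
  then have prod: "(e * det A) * (e * det B) = 1"
    using ee by (metis mult.assoc mult.commute mult.right_neutral)
  obtain a b :: int where ab: "e * det A = of_int a" "e * det B = of_int b"
    using A_int[of 0] B_int[of 0] by (auto simp: charpoly_coeff_0 e_def elim!: Ints_cases)
  have "a * b = 1" using prod unfolding ab by (metis of_int_eq_1_iff of_int_mult)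
  then have "\<bar>a\<bar> = 1" by (metis abs_zmult_eq_1 abs_one)
  then have "\<bar>e * det A\<bar> = 1" unfolding ab by (metis of_int_abs of_int_1)
  moreover have "\<bar>e\<bar> = 1"
    using ee by (metis abs_mult_self_eq abs_one square_eq_1_iff abs_minus_cancel)
  ultimately have "\<bar>det A\<bar> = 1" by (simp add: abs_mult)
  then show ?thesis using A_int by (simp add: integer_like_Q_def)
qed

section \<open>Galois descent\<close>

lemma matrix_vector_mult_sum_right:
  fixes A :: "'a::comm_ring_1 ^ 'n::finite ^ 'm::finite"
  shows "A *v (\<Sum>i\<in>I. g i) = (\<Sum>i\<in>I. A *v g i)"
  by (induction I rule: infinite_finite_induct) (auto simp: matrix_vector_right_distrib)

text \<open>A family is handled through the matrix having it as columns, so that comparing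
  coordinates becomes cancelling an invertible matrix.\<close>

lemma lincomb_columns:
  fixes b :: "'n::finite \<Rightarrow> 'a::comm_ring_1 ^ 'm::finite"
  shows "(\<chi> i j. b j $ i) *v x = (\<Sum>j\<in>UNIV. x $ j *s b j)"
  by (simp add: matrix_vector_mult_def vec_eq_iff mult.commute)

lemma invertible_vec_cancel:
  fixes M :: "'a::comm_ring_1 ^ 'n::finite ^ 'n"
  assumes "invertible M" "M *v x = M *v y"
  shows "x = y"
  using assms by (metis invertible_def matrix_vector_mul_assoc matrix_vector_mul_lid)

section \<open>The bracket under extension of scalars\<close>

context
  fixes c :: "'n::finite \<Rightarrow> 'n \<Rightarrow> 'n \<Rightarrow> rat"
begin

lemma brk_add_left: "brk c (u + v) w = brk c u w + brk c v w"
  and brk_add_right: "brk c w (u + v) = brk c w u + brk c w v"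
  by (simp_all add: brk_def vec_eq_iff algebra_simps sum.distrib)

lemma brk_scale_left: "brk c (x *s v) w = x *s brk c v w"
  and brk_scale_right: "brk c v (x *s w) = x *s brk c v w"
  by (simp_all add: brk_def vec_eq_iff sum_distrib_left mult_ac)

lemma brk_sum_left: "brk c (\<Sum>i\<in>I. g i) w = (\<Sum>i\<in>I. brk c (g i) w)"
proof (induction I rule: infinite_finite_induct)
  case empty
  show ?case using brk_scale_left[of 0 0 w] by simp
qed (use brk_scale_left[of 0 0 w] in \<open>auto simp: brk_add_left\<close>)

lemma brk_sum_right: "brk c w (\<Sum>i\<in>I. g i) = (\<Sum>i\<in>I. brk c w (g i))"
proof (induction I rule: infinite_finite_induct)
  case empty
  show ?case using brk_scale_right[of w 0 0] by simp
qed (use brk_scale_right[of w 0 0] in \<open>auto simp: brk_add_right\<close>)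

lemma brk_lincomb:
  "brk c (\<Sum>i\<in>I. x i *s u i) (\<Sum>j\<in>J. y j *s w j) =
    (\<Sum>i\<in>I. \<Sum>j\<in>J. (x i * y j) *s brk c (u i) (w j))"
  by (subst sum.swap) (simp add: brk_sum_left brk_sum_right brk_scale_left brk_scale_right
      vector_smult_assoc vec.scale_sum_right mult.commute)

definition cvec :: "rat ^ 'n \<Rightarrow> complex ^ 'n" where
  "cvec v = (\<chi> i. of_rat (v $ i))"

lemma brk_cvec: "brk c (cvec v) (cvec w) = cvec (brk c v w)"
  by (simp add: brk_def cvec_def vec_eq_iff of_rat_sum of_rat_mult)

lemma ratmat_cvec: "ratmat A *v cvec v = cvec (A *v v)"
  by (simp add: ratmat_def cvec_def vec_eq_iff matrix_vector_mult_def of_rat_sum of_rat_mult)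

text \<open>The unit vectors are written as \<open>cvec\<close> images so that brackets and rational
  matrices can be evaluated on them over Q.\<close>

lemma cvec_expansion: "v = (\<Sum>i\<in>UNIV. v $ i *s cvec (axis i 1))"
proof -
  have "cvec (axis i 1) = axis i 1" for i
    by (simp add: cvec_def axis_def vec_eq_iff)
  then show ?thesis by (simp add: basis_expansion)
qed

text \<open>Both sides are bilinear, so it suffices to compare them on unit vectors, where the
  identity is the rational one.\<close>

lemma lie_aut_ratmat:
  assumes "lie_aut_Q c A"
  shows "ratmat A *v brk c v w = brk c (ratmat A *v v) (ratmat A *v w)"
proof -
  let ?e = "\<lambda>i. cvec (axis i 1)"
  have basis: "ratmat A *v brk c (?e i) (?e j) = brk c (ratmat A *v ?e i) (ratmat A *v ?e j)" for i j
    using assms by (simp add: brk_cvec ratmat_cvec lie_aut_Q_def)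
  have expand: "ratmat A *v v = (\<Sum>i\<in>UNIV. v $ i *s (ratmat A *v ?e i))" for v
    by (subst cvec_expansion[of v]) (simp add: matrix_vector_mult_sum_right vector_scalar_commute)
  have "ratmat A *v brk c v w = ratmat A *v
      brk c (\<Sum>i\<in>UNIV. v $ i *s ?e i) (\<Sum>j\<in>UNIV. w $ j *s ?e j)"
    by (simp flip: cvec_expansion)
  also have "\<dots> = (\<Sum>i\<in>UNIV. \<Sum>j\<in>UNIV. (v $ i * w $ j) *s brk c (ratmat A *v ?e i) (ratmat A *v ?e j))"
    unfolding brk_lincomb by (simp add: matrix_vector_mult_sum_right vector_scalar_commute basis)
  also have "\<dots> = brk c (ratmat A *v v) (ratmat A *v w)"
    unfolding expand[of v] expand[of w] brk_lincomb ..
  finally show ?thesis .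
qed

end

context
  fixes E :: "complex set"
  assumes E: "subfield_C E"
begin

lemma nE_add: "v \<in> nE E \<Longrightarrow> w \<in> nE E \<Longrightarrow> v + w \<in> nE E"
  and nE_scale: "x \<in> E \<Longrightarrow> v \<in> nE E \<Longrightarrow> x *s v \<in> nE E"
  and nE_0: "0 \<in> nE E"
  by (auto simp: nE_def subfield_add[OF E] subfield_mult[OF E] subfield_0[OF E])

lemma nE_sum: "(\<And>i. i \<in> I \<Longrightarrow> g i \<in> nE E) \<Longrightarrow> sum g I \<in> nE E"
  by (auto simp: nE_def intro: subfield_sum[OF E])

lemma nE_brk: "v \<in> nE E \<Longrightarrow> w \<in> nE E \<Longrightarrow> brk c v w \<in> nE E"
  by (auto simp: nE_def brk_def intro!: subfield_sum[OF E] subfield_mult[OF E] subfield_of_rat[OF E])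

lemma nE_mult: "mat_in E M \<Longrightarrow> v \<in> nE E \<Longrightarrow> M *v v \<in> nE E"
  by (auto simp: nE_def mat_in_def matrix_vector_mult_def intro!: subfield_sum[OF E] subfield_mult[OF E])

lemma mat_in_ratmat: "mat_in E (ratmat A)"
  by (simp add: mat_in_def ratmat_def subfield_of_rat[OF E])

lemma subfield_det: "mat_in E M \<Longrightarrow> det M \<in> E"
  unfolding det_def mat_in_def
  by (intro subfield_sum[OF E] subfield_mult[OF E] subfield_prod[OF E] subfield_of_int[OF E]) auto

text \<open>Cramer's rule writes the coordinates of x as quotients of determinants over E; solutions
  found over the complex numbers thus come back into E.\<close>

lemma nE_solution:
  fixes M :: "complex ^ 'n::finite ^ 'n"
  assumes "mat_in E M" "det M \<noteq> 0" "M *v x \<in> nE E"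
  shows "x \<in> nE E"
proof -
  let ?y = "\<chi> k. det (\<chi> i j. if j = k then (M *v x) $ i else M $ i $ j) / det M"
  have "mat_in E (\<chi> i j. if j = k then (M *v x) $ i else M $ i $ j)" for k
    using assms by (simp add: mat_in_def nE_def)
  then have "?y \<in> nE E"
    using subfield_det[OF assms(1)] by (simp add: nE_def subfield_divide[OF E] subfield_det)
  moreover have "x = ?y"
    using cramer[OF assms(2), of x "M *v x"] by simp
  ultimately show ?thesis by simp
qed

text \<open>Preimages of the unit vectors are the columns of a right inverse. This is how
  bijectivity on \<open>nE E\<close> yields an invertible complex matrix.\<close>

lemma surj_nE_invertible:
  fixes M :: "complex ^ 'n::finite ^ 'n"
  assumes "nE E \<subseteq> (\<lambda>v. M *v v) ` nE E"
  shows "invertible M"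
proof -
  have "axis i 1 \<in> nE E" for i :: 'n
    by (auto simp: nE_def axis_def subfield_0[OF E] subfield_1[OF E])
  then have "\<exists>u. M *v u = axis i 1" for i
    using assms by (metis imageE subsetD)
  then obtain u where u: "\<And>i. M *v u i = axis i 1" by metis
  have "M ** (\<chi> i j. u j $ i) = mat 1"
  proof -
    have "(M ** (\<chi> i j. u j $ i)) $ i $ j = (M *v u j) $ i" for i j
      by (simp add: matrix_matrix_mult_def matrix_vector_mult_def)
    then show ?thesis by (simp add: vec_eq_iff u mat_def axis_def)
  qed
  then show ?thesis using invertible_right_inverse by blast
qed

end

section \<open>Entrywise Galois conjugation\<close>

definition conj_vec :: "(complex \<Rightarrow> complex) \<Rightarrow> complex ^ 'n \<Rightarrow> complex ^ 'n" where
  "conj_vec \<sigma> v = (\<chi> i. \<sigma> (v $ i))"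

text \<open>For bijective \<sigma> this is \<open>gal_twist (inv \<sigma>)\<close>.\<close>

definition conj_mat :: "(complex \<Rightarrow> complex) \<Rightarrow> complex ^ 'n ^ 'm \<Rightarrow> complex ^ 'n ^ 'm" where
  "conj_mat \<sigma> M = (\<chi> i j. \<sigma> (M $ i $ j))"

context
  fixes E :: "complex set" and \<sigma> :: "complex \<Rightarrow> complex"
  assumes E: "subfield_C E" and \<sigma>: "\<sigma> \<in> Gal E"
begin

lemma conj_vec_in: "v \<in> nE E \<Longrightarrow> conj_vec \<sigma> v \<in> nE E"
  by (simp add: nE_def conj_vec_def Gal_in[OF E \<sigma>])

lemma conj_vec_add: "v \<in> nE E \<Longrightarrow> w \<in> nE E \<Longrightarrow> conj_vec \<sigma> (v + w) = conj_vec \<sigma> v + conj_vec \<sigma> w"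
  by (simp add: nE_def conj_vec_def vec_eq_iff Gal_add[OF E \<sigma>])

lemma conj_vec_0: "conj_vec \<sigma> 0 = 0"
  by (simp add: conj_vec_def vec_eq_iff Gal_0[OF E \<sigma>])

lemma conj_vec_scale: "x \<in> E \<Longrightarrow> v \<in> nE E \<Longrightarrow> conj_vec \<sigma> (x *s v) = \<sigma> x *s conj_vec \<sigma> v"
  by (simp add: nE_def conj_vec_def vec_eq_iff Gal_mult[OF E \<sigma>])

lemma conj_vec_brk:
  assumes "v \<in> nE E" "w \<in> nE E"
  shows "conj_vec \<sigma> (brk c v w) = brk c (conj_vec \<sigma> v) (conj_vec \<sigma> w)"
  using assms unfolding nE_def
  by (simp add: conj_vec_def brk_def vec_eq_iff Gal_sum[OF E \<sigma>] Gal_mult[OF E \<sigma>] Gal_of_rat[OF E \<sigma>]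
      subfield_sum[OF E] subfield_mult[OF E] subfield_of_rat[OF E])

lemma conj_vec_mult:
  assumes "mat_in E M" "v \<in> nE E"
  shows "conj_vec \<sigma> (M *v v) = conj_mat \<sigma> M *v conj_vec \<sigma> v"
  using assms unfolding nE_def mat_in_def
  by (simp add: conj_vec_def conj_mat_def matrix_vector_mult_def vec_eq_iff Gal_sum[OF E \<sigma>]
      Gal_mult[OF E \<sigma>] subfield_mult[OF E])

lemma conj_mat_ratmat: "conj_mat \<sigma> (ratmat A) = ratmat A"
  by (simp add: conj_mat_def ratmat_def vec_eq_iff Gal_of_rat[OF E \<sigma>])

end

section \<open>The twisted action and its fixed space\<close>

locale twisted_form =
  fixes E :: "complex set" and c :: "'n::finite \<Rightarrow> 'n \<Rightarrow> 'n \<Rightarrow> rat"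
    and \<rho> :: "(complex \<Rightarrow> complex) \<Rightarrow> rat ^ 'n ^ 'n"
  assumes galois: "finite_galois_ext_Q E" and rep: "gal_rep E c \<rho>"
begin

lemma E: "subfield_C E" "finite_over_Q E" "normal_over_Q E"
  using galois by (auto simp: finite_galois_ext_Q_def)

definition act :: "(complex \<Rightarrow> complex) \<Rightarrow> complex ^ 'n \<Rightarrow> complex ^ 'n" where
  "act \<sigma> v = ratmat (\<rho> \<sigma>) *v conj_vec \<sigma> v"

definition form :: "(complex ^ 'n) set" where
  "form = {v \<in> nE E. \<forall>\<sigma>\<in>Gal E. act \<sigma> v = v}"

lemma rho_comp: "\<sigma> \<in> Gal E \<Longrightarrow> \<tau> \<in> Gal E \<Longrightarrow> \<rho> (\<sigma> \<circ> \<tau>) = \<rho> \<sigma> ** \<rho> \<tau>"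
  and rho_aut: "\<sigma> \<in> Gal E \<Longrightarrow> lie_aut_Q c (\<rho> \<sigma>)"
  using rep by (auto simp: gal_rep_def)

text \<open>Multiplicativity makes \<open>\<rho> id\<close> idempotent, and an invertible idempotent
  is the identity.\<close>

lemma rho_id: "\<rho> id = mat 1"
proof -
  have "\<rho> id ** \<rho> id = \<rho> id"
    using rho_comp[OF Gal_id Gal_id] by simp
  moreover obtain B where "B ** \<rho> id = mat 1"
    using rho_aut[OF Gal_id] by (auto simp: lie_aut_Q_def invertible_def)
  ultimately show ?thesis by (metis matrix_mul_assoc matrix_mul_lid)
qed

lemma act_id: "act id v = v"
  by (simp add: act_def rho_id ratmat_mat_1 conj_vec_def)

lemma act_in: "\<sigma> \<in> Gal E \<Longrightarrow> v \<in> nE E \<Longrightarrow> act \<sigma> v \<in> nE E"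
  unfolding act_def by (intro nE_mult[OF E(1)] mat_in_ratmat[OF E(1)] conj_vec_in[OF E(1)])

lemma act_add: "\<sigma> \<in> Gal E \<Longrightarrow> v \<in> nE E \<Longrightarrow> w \<in> nE E \<Longrightarrow> act \<sigma> (v + w) = act \<sigma> v + act \<sigma> w"
  by (simp add: act_def conj_vec_add[OF E(1)] matrix_vector_right_distrib)

lemma act_0: "\<sigma> \<in> Gal E \<Longrightarrow> act \<sigma> 0 = 0"
  by (simp add: act_def conj_vec_0[OF E(1)])

lemma act_sum:
  assumes "\<sigma> \<in> Gal E"
  shows "(\<And>i. i \<in> I \<Longrightarrow> g i \<in> nE E) \<Longrightarrow> act \<sigma> (sum g I) = (\<Sum>i\<in>I. act \<sigma> (g i))"
  by (induction I rule: infinite_finite_induct)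
    (auto simp: act_0[OF assms] act_add[OF assms] nE_sum[OF E(1)])

lemma act_scale: "\<sigma> \<in> Gal E \<Longrightarrow> x \<in> E \<Longrightarrow> v \<in> nE E \<Longrightarrow> act \<sigma> (x *s v) = \<sigma> x *s act \<sigma> v"
  by (simp add: act_def conj_vec_scale[OF E(1)] vector_scalar_commute)

lemma act_brk:
  "\<sigma> \<in> Gal E \<Longrightarrow> v \<in> nE E \<Longrightarrow> w \<in> nE E \<Longrightarrow> act \<sigma> (brk c v w) = brk c (act \<sigma> v) (act \<sigma> w)"
  by (simp add: act_def conj_vec_brk[OF E(1)] lie_aut_ratmat[OF rho_aut])

text \<open>Conjugation by \<sigma> passes through the matrix of \<open>\<rho> \<tau>\<close>, whose
  entries are rational.\<close>

lemma act_comp: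
  assumes "\<sigma> \<in> Gal E" "\<tau> \<in> Gal E" "v \<in> nE E"
  shows "act (\<sigma> \<circ> \<tau>) v = act \<sigma> (act \<tau> v)"
proof -
  have "conj_vec \<sigma> (ratmat (\<rho> \<tau>) *v conj_vec \<tau> v) = ratmat (\<rho> \<tau>) *v conj_vec \<sigma> (conj_vec \<tau> v)"
    using conj_vec_mult[OF E(1) assms(1) mat_in_ratmat[OF E(1)] conj_vec_in[OF E(1) assms(2,3)]]
    by (simp add: conj_mat_ratmat[OF E(1) assms(1)])
  moreover have "conj_vec \<sigma> (conj_vec \<tau> v) = conj_vec (\<sigma> \<circ> \<tau>) v"
    by (simp add: conj_vec_def)
  ultimately show ?thesis
    by (simp add: act_def rho_comp[OF assms(1,2)] ratmat_mult matrix_vector_mul_assoc)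
qed

lemma bij_Gal_comp:
  assumes "\<sigma> \<in> Gal E"
  shows "bij_betw (\<lambda>\<tau>. \<sigma> \<circ> \<tau>) (Gal E) (Gal E)"
proof (rule bij_betw_byWitness[where f' = "\<lambda>\<tau>. inv \<sigma> \<circ> \<tau>"])
  have "inv \<sigma> \<circ> \<sigma> = id" "\<sigma> \<circ> inv \<sigma> = id"
    using Gal_bij[OF E(1) assms] by (auto simp: bij_def surj_iff)
  then show "\<forall>\<tau>\<in>Gal E. inv \<sigma> \<circ> (\<sigma> \<circ> \<tau>) = \<tau>" "\<forall>\<tau>\<in>Gal E. \<sigma> \<circ> (inv \<sigma> \<circ> \<tau>) = \<tau>"
    by (metis comp_assoc id_comp)+
  show "(\<lambda>\<tau>. \<sigma> \<circ> \<tau>) ` Gal E \<subseteq> Gal E" "(\<lambda>\<tau>. inv \<sigma> \<circ> \<tau>) ` Gal E \<subseteq> Gal E"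
    using Gal_comp[OF E(1)] assms Gal_inv[OF E(1) assms] by auto
qed

text \<open>Left multiplication by \<sigma> merely permutes the summands.\<close>

lemma trace_in_form:
  assumes "v \<in> nE E"
  shows "(\<Sum>\<tau>\<in>Gal E. act \<tau> v) \<in> form"
  unfolding form_def
proof safe
  show "(\<Sum>\<tau>\<in>Gal E. act \<tau> v) \<in> nE E"
    using assms by (intro nE_sum[OF E(1)] act_in)
  fix \<sigma> assume \<sigma>: "\<sigma> \<in> Gal E"
  have "act \<sigma> (\<Sum>\<tau>\<in>Gal E. act \<tau> v) = (\<Sum>\<tau>\<in>Gal E. act (\<sigma> \<circ> \<tau>) v)"
    using assms \<sigma> by (simp add: act_sum act_in act_comp)
  also have "\<dots> = (\<Sum>\<tau>\<in>Gal E. act \<tau> v)"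
    by (rule sum.reindex_bij_betw[OF bij_Gal_comp[OF \<sigma>]])
  finally show "act \<sigma> (\<Sum>\<tau>\<in>Gal E. act \<tau> v) = (\<Sum>\<tau>\<in>Gal E. act \<tau> v)" .
qed

text \<open>With a primitive element \<open>\<theta>\<close>, the traces of \<open>\<theta>\<^sup>i v\<close> span all combinations of the
  \<open>act \<tau> v\<close> with weights \<open>g (\<tau> \<theta>)\<close>, \<open>g\<close> a complex polynomial; Lagrange interpolation isolates \<open>v\<close>.\<close>

lemma nE_subset_span_form: "nE E \<subseteq> vec.span form"
proof
  fix v :: "complex ^ 'n" assume v: "v \<in> nE E"
  obtain \<theta> where \<theta>: "\<theta> \<in> E" "E = Q_adjoin \<theta>"
    using primitive_element[OF E(1,2)] .
  have fin: "finite (Gal E)" by (rule finite_Gal[OF E(1,2)])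
  have pow: "(\<Sum>\<tau>\<in>Gal E. (\<tau> \<theta>) ^ i *s act \<tau> v) \<in> form" for i
    using trace_in_form[OF nE_scale[OF E(1) subfield_power[OF E(1) \<theta>(1), of i] v]]
    by (simp add: act_scale subfield_power[OF E(1) \<theta>(1)] v Gal_power[OF E(1) _ \<theta>(1)])
  have span: "(\<Sum>\<tau>\<in>Gal E. poly g (\<tau> \<theta>) *s act \<tau> v) \<in> vec.span form" for g
  proof -
    have "(\<Sum>\<tau>\<in>Gal E. poly g (\<tau> \<theta>) *s act \<tau> v) =
        (\<Sum>\<tau>\<in>Gal E. \<Sum>i\<le>degree g. coeff g i *s ((\<tau> \<theta>) ^ i *s act \<tau> v))"
      by (simp add: poly_altdef vec.scale_sum_left vector_smult_assoc)
    also have "\<dots> = (\<Sum>i\<le>degree g. coeff g i *s (\<Sum>\<tau>\<in>Gal E. (\<tau> \<theta>) ^ i *s act \<tau> v))"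
      by (subst sum.swap) (simp add: vec.scale_sum_right)
    also have "\<dots> \<in> vec.span form"
      by (intro vec.span_sum vec.span_scale vec.span_base pow)
    finally show ?thesis .
  qed
  define g where "g = (\<Prod>\<tau>\<in>Gal E - {id}. [:- \<tau> \<theta>, 1:])"
  have g_id: "poly g \<theta> \<noteq> 0"
    unfolding g_def poly_prod using fin Gal_eqI[OF E(1) \<theta>(2,1) _ Gal_id] by auto
  have "(\<Sum>\<tau>\<in>Gal E. poly g (\<tau> \<theta>) *s act \<tau> v) =
      poly g (id \<theta>) *s act id v + (\<Sum>\<tau>\<in>Gal E - {id}. poly g (\<tau> \<theta>) *s act \<tau> v)"
    by (rule sum.remove[OF fin Gal_id])
  also have "(\<Sum>\<tau>\<in>Gal E - {id}. poly g (\<tau> \<theta>) *s act \<tau> v) = 0"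
    using fin by (intro sum.neutral) (auto simp: g_def poly_prod prod_zero_iff)
  finally have "(\<Sum>\<tau>\<in>Gal E. poly g (\<tau> \<theta>) *s act \<tau> v) = poly g \<theta> *s v"
    unfolding act_id add_0_right by (simp only: id_apply)
  then have "poly g \<theta> *s v \<in> vec.span form"
    using span[of g] by simp
  then have "inverse (poly g \<theta>) *s (poly g \<theta> *s v) \<in> vec.span form"
    by (rule vec.span_scale)
  then show "v \<in> vec.span form"
    using g_id by (simp add: vector_smult_assoc)
qed

text \<open>All unit vectors lie in \<open>nE E\<close>, so the complex span of \<open>form\<close>
  is the whole space and a complex basis can be selected inside \<open>form\<close>. Independence
  over the complex numbers, stronger than over Q, is what makes the determinant nonzero.\<close>

lemma form_basis_matrix:
  obtains b where "\<And>i. b i \<in> form" "det (\<chi> i j. b j $ i) \<noteq> 0"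
proof -
  have "axis i 1 \<in> nE E" for i :: 'n
    by (auto simp: nE_def axis_def subfield_0[OF E(1)] subfield_1[OF E(1)])
  then have "(\<Sum>i\<in>UNIV. v $ i *s axis i 1) \<in> vec.span form" for v :: "complex ^ 'n"
    using nE_subset_span_form by (intro vec.span_sum vec.span_scale) blast
  then have "vec.span form = UNIV" by (auto simp: basis_expansion)
  then obtain B where B: "B \<subseteq> form" "vec.independent B" "vec.span B = UNIV"
    using vec.maximal_independent_subset[of form] by (metis top.extremum_uniqueI vec.span_minimal vec.subspace_span)
  have "card B = vec.dim (UNIV :: (complex ^ 'n) set)"
    using B by (metis vec.dim_eq_card_independent vec.dim_span)
  then have "card B = CARD('n)" by (simp add: vec.dim_UNIV card_cart_basis)
  moreover have "finite B" using B(2) vec.finiteI_independent by blast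
  ultimately obtain b where b: "bij_betw b (UNIV :: 'n set) B"
    by (metis finite finite_same_card_bij)
  let ?M = "\<chi> i j. b j $ i"
  have "columns ?M = range b"
    by (auto simp: columns_def column_def)
  then have "vec.span (columns ?M) = UNIV"
    using b B(3) by (simp add: bij_betw_def)
  then have "invertible ?M"
    using matrix_right_invertible_span_columns[of ?M] invertible_right_inverse[of ?M] by blast
  then have "det ?M \<noteq> 0" by (simp add: invertible_det_nz)
  moreover have "b i \<in> form" for i
    using b B(1) by (auto simp: bij_betw_def)
  ultimately show ?thesis by (rule that[rotated])
qed

lemma form_subset: "form \<subseteq> nE E"
  by (auto simp: form_def)

lemma subalgebra_form: "rational_subalgebra c form"
  unfolding rational_subalgebra_def form_def
  by (auto simp: nE_0[OF E(1)] nE_add[OF E(1)] nE_brk[OF E(1)] nE_scale[OF E(1)] subfield_of_rat[OF E(1)]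
      act_0 act_add act_brk act_scale Gal_of_rat[OF E(1)])

text \<open>Apply \<open>act \<sigma>\<close> to the expansion of v: v and the basis vectors stay
  fixed while the coordinates are conjugated. Since coordinates are unique, each is invariant under
  every \<sigma>.\<close>

lemma form_rational_coordinates:
  assumes b: "\<And>i. b i \<in> form" and det: "det (\<chi> i j. b j $ i) \<noteq> 0" and v: "v \<in> form"
    and a: "a \<in> nE E" "v = (\<Sum>i\<in>UNIV. a $ i *s b i)"
  shows "\<exists>q. a $ i = of_rat q"
proof -
  let ?M = "\<chi> i j. b j $ i"
  note lin = lincomb_columns[of b]
  have aE: "a $ i \<in> E" for i using a(1) by (simp add: nE_def)
  have "\<sigma> (a $ i) = a $ i" if \<sigma>: "\<sigma> \<in> Gal E" for \<sigma>
  proof -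
    have bE: "b i \<in> nE E" "act \<sigma> (b i) = b i" for i
      using b \<sigma> by (auto simp: form_def)
    have "?M *v a = act \<sigma> v"
      using v \<sigma> a(2) by (simp add: lin form_def)
    also have "\<dots> = (\<Sum>i\<in>UNIV. \<sigma> (a $ i) *s b i)"
      unfolding a(2) by (simp add: act_sum[OF \<sigma>] nE_scale[OF E(1)] aE bE act_scale[OF \<sigma>])
    also have "\<dots> = ?M *v conj_vec \<sigma> a" by (simp add: lin conj_vec_def)
    finally have "?M *v a = ?M *v conj_vec \<sigma> a" .
    moreover have "invertible ?M" using det by (simp add: invertible_det_nz)
    ultimately have "a = conj_vec \<sigma> a" by (rule invertible_vec_cancel[rotated])
    then show ?thesis by (metis conj_vec_def vec_lambda_beta)
  qed
  then show ?thesis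
    using Gal_fixed_rational[OF E aE[of i]] by metis
qed

text \<open>Uniqueness holds already for complex coordinates, by invertibility. Existence over E is
  Cramer's rule, and existence over Q for vectors of \<open>form\<close> is Galois
  invariance.\<close>

lemma form_bases:
  assumes b: "\<And>i. b i \<in> form" and det: "det (\<chi> i j. b j $ i) \<noteq> 0"
  shows "E_basis E b" "Q_basis form b"
proof -
  let ?M = "\<chi> i j. b j $ i"
  note lin = lincomb_columns[of b]
  have inv: "invertible ?M" using det by (simp add: invertible_det_nz)
  have inj: "x = y" if "(\<Sum>i\<in>UNIV. x i *s b i) = (\<Sum>i\<in>UNIV. y i *s b i)" for x y
  proof -
    have "?M *v (\<chi> i. x i) = ?M *v (\<chi> i. y i)"
      using that by (simp add: lin)
    then have "(\<chi> i. x i) = (\<chi> i. y i)"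
      by (rule invertible_vec_cancel[OF inv])
    then show ?thesis by (metis (no_types) vec_lambda_inverse UNIV_I vec_lambda_beta ext)
  qed
  have M: "mat_in E ?M"
    using b form_subset by (auto simp: mat_in_def nE_def)
  have sol: "\<exists>a\<in>nE E. v = (\<Sum>i\<in>UNIV. a $ i *s b i)" if v: "v \<in> nE E" for v
  proof -
    obtain N where "?M ** N = mat 1" using inv by (auto simp: invertible_def)
    then have N: "?M *v (N *v v) = v" by (simp add: matrix_vector_mul_assoc)
    then have "N *v v \<in> nE E"
      using nE_solution[OF E(1) M det] v by simp
    then show ?thesis using N lin by metis
  qed
  show "E_basis E b"
    unfolding E_basis_def
  proof (intro conjI allI ballI)
    show "b i \<in> nE E" for i using b form_subset by auto
    fix v :: "complex ^ 'n" assume "v \<in> nE E"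
    then obtain a where a: "a \<in> nE E" "v = (\<Sum>i\<in>UNIV. a $ i *s b i)" using sol by blast
    show "\<exists>!a. (\<forall>i. a i \<in> E) \<and> v = (\<Sum>i\<in>UNIV. a i *s b i)"
    proof (rule ex1I[of _ "\<lambda>i. a $ i"])
      show "(\<forall>i. a $ i \<in> E) \<and> v = (\<Sum>i\<in>UNIV. a $ i *s b i)"
        using a by (simp add: nE_def)
    qed (use a inj in auto)
  qed
  show "Q_basis form b"
    unfolding Q_basis_def
  proof (intro conjI allI ballI)
    show "b i \<in> form" for i by (rule b)
    fix v assume v: "v \<in> form"
    then obtain a where a: "a \<in> nE E" "v = (\<Sum>i\<in>UNIV. a $ i *s b i)" using sol form_subset by blast
    obtain q where q: "\<And>i. a $ i = of_rat (q i)"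
      using form_rational_coordinates[OF b det v a] by metis
    show "\<exists>!q. v = (\<Sum>i\<in>UNIV. of_rat (q i) *s b i)"
    proof (rule ex1I[of _ q])
      show "v = (\<Sum>i\<in>UNIV. of_rat (q i) *s b i)" using a(2) q by simp
      fix q' assume "v = (\<Sum>i\<in>UNIV. of_rat (q' i) *s b i)"
      then have "(\<lambda>i. of_rat (q' i) :: complex) = (\<lambda>i. of_rat (q i))"
        using a(2) q by (intro inj) simp
      then show "q' = q" by (metis ext of_rat_eq_iff)
    qed
  qed
qed

section \<open>Invariance of the fixed space under f\<close>

context
  fixes f :: "complex ^ 'n ^ 'n"
  assumes f: "lie_aut_E E c f"
    and equiv: "\<forall>\<sigma>\<in>Gal E. ratmat (\<rho> \<sigma>) ** f ** ratmat (\<rho> (inv \<sigma>)) = gal_twist \<sigma> f"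
begin

lemma act_f:
  assumes \<sigma>: "\<sigma> \<in> Gal E" and v: "v \<in> nE E"
  shows "act \<sigma> (f *v v) = f *v act \<sigma> v"
proof -
  have fE: "mat_in E f" using f by (simp add: lie_aut_E_def)
  have bij: "bij \<sigma>" by (rule Gal_bij[OF E(1) \<sigma>])
  have \<sigma>': "inv \<sigma> \<in> Gal E" by (rule Gal_inv[OF E(1) \<sigma>])
  have "\<rho> \<sigma> ** \<rho> (inv \<sigma>) = mat 1"
    using rho_comp[OF \<sigma> \<sigma>'] bij rho_id by (simp add: bij_def surj_iff)
  then have cancel: "ratmat (\<rho> \<sigma>) ** ratmat (\<rho> (inv \<sigma>)) = mat 1"
    by (simp add: ratmat_mat_1 flip: ratmat_mult)
  \<comment> \<open>The hypothesis at \<open>inv \<sigma>\<close>: there the twist applies \<sigma>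
    itself to the entries, as the action does.\<close>
  have "ratmat (\<rho> (inv \<sigma>)) ** f ** ratmat (\<rho> \<sigma>) = conj_mat \<sigma> f"
    using equiv \<sigma>' bij by (fastforce simp: gal_twist_def conj_mat_def inv_inv_eq)
  then have "ratmat (\<rho> \<sigma>) ** conj_mat \<sigma> f = (ratmat (\<rho> \<sigma>) ** ratmat (\<rho> (inv \<sigma>))) ** f ** ratmat (\<rho> \<sigma>)"
    by (metis matrix_mul_assoc)
  then have "ratmat (\<rho> \<sigma>) ** conj_mat \<sigma> f = f ** ratmat (\<rho> \<sigma>)"
    by (simp add: cancel)
  then show ?thesis
    by (simp add: act_def conj_vec_mult[OF E(1) \<sigma> fE v] matrix_vector_mul_assoc)
qed

text \<open>To get equality and not mere inclusion, a fixed vector is pulled back to some u in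
  \<open>nE E\<close>; then u and \<open>act \<sigma> u\<close> have the same image, and f is
  injective there.\<close>

lemma image_form: "(\<lambda>v. f *v v) ` form = form"
proof (intro equalityI subsetI)
  have bij: "bij_betw (\<lambda>v. f *v v) (nE E) (nE E)" using f by (simp add: lie_aut_E_def)
  have im: "(\<lambda>v. f *v v) ` nE E = nE E" and inj: "inj_on (\<lambda>v. f *v v) (nE E)"
    using bij by (auto simp: bij_betw_def)
  {
    fix v assume "v \<in> (\<lambda>v. f *v v) ` form"
    then obtain u where "u \<in> form" "v = f *v u" by auto
    then show "v \<in> form" using im by (auto simp: form_def act_f)
  next
    fix v assume v: "v \<in> form"
    then have "v \<in> nE E" by (simp add: form_def)
    then obtain u where u: "u \<in> nE E" "v = f *v u" using im by (metis imageE)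
    have "act \<sigma> u = u" if \<sigma>: "\<sigma> \<in> Gal E" for \<sigma>
    proof (rule inj_onD[OF inj])
      show "f *v act \<sigma> u = f *v u"
        using v \<sigma> u by (simp add: form_def flip: act_f)
    qed (use u \<sigma> act_in in auto)
    then show "v \<in> (\<lambda>v. f *v v) ` form" using u by (auto simp: form_def)
  }
qed

end

end


text \<open>With d as structure constants in the basis b, passing from rational coordinates to
  actual vectors is a homomorphism of brackets.\<close>

lemma brk_change_basis:
  fixes b :: "'n::finite \<Rightarrow> complex ^ 'n"
  assumes d: "\<And>i j. brk c (b i) (b j) = (\<Sum>k\<in>UNIV. of_rat (d i j k) *s b k)"
  shows "(\<chi> i j. b j $ i) *v cvec (brk d v w) =
    brk c ((\<chi> i j. b j $ i) *v cvec v) ((\<chi> i j. b j $ i) *v cvec w)"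
proof -
  have "(\<chi> i j. b j $ i) *v cvec (brk d v w) =
      (\<Sum>k\<in>UNIV. \<Sum>i\<in>UNIV. \<Sum>j\<in>UNIV. (of_rat (v $ i) * of_rat (w $ j) * of_rat (d i j k)) *s b k)"
    by (simp add: lincomb_columns brk_def cvec_def of_rat_sum of_rat_mult vec.scale_sum_left)
  also have "\<dots> = (\<Sum>i\<in>UNIV. \<Sum>k\<in>UNIV. \<Sum>j\<in>UNIV.
      (of_rat (v $ i) * of_rat (w $ j) * of_rat (d i j k)) *s b k)"
    by (rule sum.swap)
  also have "\<dots> = (\<Sum>i\<in>UNIV. \<Sum>j\<in>UNIV. \<Sum>k\<in>UNIV.
      (of_rat (v $ i) * of_rat (w $ j) * of_rat (d i j k)) *s b k)"
    by (intro sum.cong refl sum.swap)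
  also have "\<dots> = brk c ((\<chi> i j. b j $ i) *v cvec v) ((\<chi> i j. b j $ i) *v cvec w)"
    by (simp add: lincomb_columns brk_lincomb d cvec_def vec.scale_sum_right vector_smult_assoc)
  finally show ?thesis .
qed

lemma cvec_inj: "cvec v = cvec w \<Longrightarrow> v = w"
  by (simp add: cvec_def vec_eq_iff)

lemma det_ratmat: "det (ratmat A) = of_rat (det A)"
  unfolding ratmat_def by (rule det_hom[symmetric]) (auto simp: of_rat_add of_rat_mult)

text \<open>In the basis b the map f has matrix A, that is f M = M A for the matrix M with columns
  b. Eigenvectors, determinant and bracket are transferred through M, so each condition on A is read
  off from f.\<close>

lemma anosov_restriction:
  fixes f :: "complex ^ 'n::finite ^ 'n" and b :: "'n \<Rightarrow> complex ^ 'n"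
  assumes E: "subfield_C E" and f: "lie_aut_E E c f"
    and b: "\<And>i. b i \<in> nE E" "det (\<chi> i j. b j $ i) \<noteq> 0"
    and d: "\<And>i j. brk c (b i) (b j) = (\<Sum>k\<in>UNIV. of_rat (d i j k) *s b k)"
    and A: "\<And>j. f *v b j = (\<Sum>i\<in>UNIV. of_rat (A $ i $ j) *s b i)"
    and eig: "\<And>z. eigenvalue f z \<Longrightarrow> algebraic_unit z \<and> cmod z \<noteq> 1"
  shows "anosov_Q d A"
proof -
  let ?M = "\<chi> i j. b j $ i"
  have invM: "invertible ?M" using b(2) by (simp add: invertible_det_nz)
  have conj: "f ** ?M = ?M ** ratmat A"
  proof -
    have "(f ** ?M) $ i $ j = (f *v b j) $ i" for i j
      by (simp add: matrix_matrix_mult_def matrix_vector_mult_def)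
    then show ?thesis
      by (simp add: vec_eq_iff A matrix_matrix_mult_def ratmat_def mult.commute)
  qed
  have conj_v: "f *v (?M *v x) = ?M *v (ratmat A *v x)" for x
    by (simp add: matrix_vector_mul_assoc conj)
  have eigA: "eigenvalue f z" if "eigenvalue (ratmat A) z" for z
  proof -
    obtain v where v: "v \<noteq> 0" "ratmat A *v v = z *s v" using \<open>eigenvalue (ratmat A) z\<close> by (auto simp: eigenvalue_def)
    have "f *v (?M *v v) = z *s (?M *v v)"
      by (simp add: conj_v v(2) vector_scalar_commute)
    moreover have "?M *v v \<noteq> 0"
      using invertible_vec_cancel[OF invM, of v 0] v(1) by auto
    ultimately show ?thesis unfolding eigenvalue_def by blast
  qed
  have "det f \<noteq> 0"
    using surj_nE_invertible[OF E, of f] f by (simp add: lie_aut_E_def bij_betw_def invertible_det_nz)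
  moreover have "det f * det ?M = det ?M * det (ratmat A)"
    using arg_cong[OF conj, of det] by (simp add: det_mul)
  ultimately have "det A \<noteq> 0" using b(2) by (auto simp: det_ratmat)
  then have invA: "invertible A" by (simp add: invertible_det_nz)
  \<comment> \<open>Both sides are compared after the injective map from coordinates into
    \<open>nE E\<close>, where f respects the bracket.\<close>
  have aut: "A *v brk d v w = brk d (A *v v) (A *v w)" for v w
  proof -
    let ?\<phi> = "\<lambda>v. ?M *v cvec v"
    have inE: "?\<phi> v \<in> nE E" for v
      unfolding lincomb_columns
      by (intro nE_sum[OF E] nE_scale[OF E] b(1)) (simp add: cvec_def subfield_of_rat[OF E])
    have f\<phi>: "f *v ?\<phi> v = ?\<phi> (A *v v)" for v
      by (simp add: conj_v ratmat_cvec)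
    have "?\<phi> (A *v brk d v w) = f *v brk c (?\<phi> v) (?\<phi> w)"
      by (simp add: f\<phi> flip: brk_change_basis[of c b d, OF d])
    also have "\<dots> = brk c (f *v ?\<phi> v) (f *v ?\<phi> w)"
      using f inE by (simp add: lie_aut_E_def)
    also have "\<dots> = ?\<phi> (brk d (A *v v) (A *v w))"
      by (simp add: f\<phi> brk_change_basis[of c b d, OF d])
    finally show ?thesis
      by (rule cvec_inj[OF invertible_vec_cancel[OF invM]])
  qed
  show ?thesis
    unfolding anosov_Q_def lie_aut_Q_def hyperbolic_Q_def
    using invA aut eigA eig integer_like_of_unit_eigenvalues[OF invA] by blast
qed

text \<open>\<open>anosov_Q\<close> speaks of a Lie algebra given by structure constants, so the
  Anosov property of m is expressed in a rational basis b: d holds the structure constants of m, and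
  A is the matrix of the restriction of f.\<close>

theorem theorem2p7:
  fixes E :: "complex set"
    and c :: "'n::finite \<Rightarrow> 'n \<Rightarrow> 'n \<Rightarrow> rat"
    and \<rho> :: "(complex \<Rightarrow> complex) \<Rightarrow> rat ^ 'n ^ 'n"
    and f :: "complex ^ 'n ^ 'n"
  assumes "finite_galois_ext_Q E"
    and "lie_algebra_Q c"
    and "gal_rep E c \<rho>"
    and "lie_aut_E E c f"
    and "\<forall>\<sigma>\<in>Gal E. ratmat (\<rho> \<sigma>) ** f ** ratmat (\<rho> (inv \<sigma>)) = gal_twist \<sigma> f"
  shows "\<exists>m. rational_form E c m \<and> (\<lambda>v. f *v v) ` m = m \<and>
           ((\<forall>z. eigenvalue f z \<longrightarrow> algebraic_unit z \<and> cmod z \<noteq> 1) \<longrightarrow>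
              (\<exists>b :: 'n \<Rightarrow> complex ^ 'n. \<exists>d :: 'n \<Rightarrow> 'n \<Rightarrow> 'n \<Rightarrow> rat. \<exists>A :: rat ^ 'n ^ 'n.
                 Q_basis m b \<and>
                 (\<forall>i j. brk c (b i) (b j) = (\<Sum>k\<in>UNIV. of_rat (d i j k) *s b k)) \<and>
                 (\<forall>j. f *v b j = (\<Sum>i\<in>UNIV. of_rat (A $ i $ j) *s b i)) \<and>
                 anosov_Q d A))"
proof -
  interpret twisted_form E c \<rho>
    by unfold_locales (use assms in auto)
  note f = assms(4,5)
  obtain b where b: "\<And>i. b i \<in> form" "det (\<chi> i j. b j $ i) \<noteq> 0"
    using form_basis_matrix by blast
  note bases = form_bases[OF b]
  have ratform: "rational_form E c form"
    unfolding rational_form_def using form_subset subalgebra_form bases by blast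
  have coords: "\<exists>q. v = (\<Sum>i\<in>UNIV. of_rat (q i) *s b i)" if "v \<in> form" for v
    using bases(2) that by (auto simp: Q_basis_def)
  have "brk c (b i) (b j) \<in> form" for i j
    using subalgebra_form b(1) by (auto simp: rational_subalgebra_def)
  then have "\<forall>i j. \<exists>q. brk c (b i) (b j) = (\<Sum>k\<in>UNIV. of_rat (q k) *s b k)"
    using coords by blast
  then obtain d where d: "\<And>i j. brk c (b i) (b j) = (\<Sum>k\<in>UNIV. of_rat (d i j k) *s b k)"
    by metis
  have "f *v b j \<in> form" for j
    using image_form[OF f] b(1) by blast
  then have "\<forall>j. \<exists>q. f *v b j = (\<Sum>i\<in>UNIV. of_rat (q i) *s b i)"
    using coords by blast
  then obtain A' where A': "\<And>j. f *v b j = (\<Sum>i\<in>UNIV. of_rat (A' j i) *s b i)"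
    by metis
  \<comment> \<open>\<open>A' j\<close> lists the coordinates of the image of the j-th basis vector,
    which form a column of A; hence the exchange of indices.\<close>
  define A :: "rat ^ 'n ^ 'n" where "A = (\<chi> i j. A' j i)"
  have A: "f *v b j = (\<Sum>i\<in>UNIV. of_rat (A $ i $ j) *s b i)" for j
    by (simp add: A_def A')
  have bE: "b i \<in> nE E" for i
    using b(1) form_subset by blast
  have "anosov_Q d A" if "\<forall>z. eigenvalue f z \<longrightarrow> algebraic_unit z \<and> cmod z \<noteq> 1"
    by (rule anosov_restriction[OF E(1) f(1) bE b(2) d A]) (use that in auto)
  then show ?thesis
    using ratform image_form[OF f] bases(2) d A by blast
qed

end
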